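(* Let $L,m,\beta>0$. (i) Let $2<p<6$, $\lambda\in\mathbb{R}$, $\kappa>0$. Then $$\int_\Omega e^{\frac{\lambda}{p}\|\phi\|_p^p-\kappa\|\phi\|_2^{2r}}\,d\mu_\beta(\phi)<\infty$$ whenever $r>\dfrac{2\alpha p+2}{4\alpha+4-p}$ for some $\alpha\in(0,1/2)$ with $4\alpha+4-p>0$. (ii) For all $\mu\in\mathbb{R}$, all $\kappa>0$ and all $\gamma<1/8$, $$\int_\Omega \exp\left[\mu\left|\int_{\mathbb{T}^1}|\phi|^2\,\overline{\phi}\,(m^2-\Delta)^\gamma\phi\,dx\right|-\kappa\|\phi\|_2^{2r}\right]d\mu_\beta(\phi)<\infty$$ whenever $r>9$.
   Context: $\mathbb{T}^1$ is the circle of circumference $L$, $\Delta$ its Laplacian, $\Omega=C(\mathbb{T}^1)$ the space of continuous complex-valued functions on it, and $\|\cdot\|_q$ the norm of $L^q(\mathbb{T}^1)$. For $k\in\mathbb{Z}$ let $u_k(x)=L^{-1/2}e^{2\pi i kx/L}$ and $\theta_k=\beta((2\pi k/L)^2+m^2)$. $\mu_\beta$ is the centered Gaussian probability measure on $\Omega$ with covariance $\beta^{-1}(m^2-\Delta)^{-1}$ on $L^2(\mathbb{T}^1)$ regarded as a real Hilbert space with inner product $\Re\langle\cdot,\cdot\rangle_{L^2}$; that is, under $\mu_\beta$ the Fourier coefficients $X_k=\langle u_k,\phi\rangle_{L^2}$ are independent, and the law of $X_k$ on $\mathbb{C}\cong\mathbb{R}^2$ has density $\frac{\theta_k}{2\pi}e^{-\theta_k|x|^2/2}$.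 The operator $(m^2-\Delta)^\gamma$ is defined by Fourier series; for $\gamma<1/8$, $(m^2-\Delta)^\gamma\phi\in L^2(\mathbb{T}^1)$ for $\mu_\beta$-almost every $\phi$. *)

theory Defs
  imports "HOL-Probability.Probability"
begin

text \<open>The circle of circumference \<open>L\<close> is the real line modulo \<open>L\<close>: functions on it are
  \<open>L\<close>-periodic functions on the line, and integrals over it are Lebesgue integrals over a period.
  A continuous periodic function is bounded, so the continuous functions on the circle are the
  periodic elements of the type of bounded continuous functions, with the sup metric.\<close>

definition circle_fun :: "real \<Rightarrow> (real \<Rightarrow>\<^sub>C complex) set" where
  "circle_fun L = {\<phi>. \<forall>x. apply_bcontfun \<phi> (x + L) = apply_bcontfun \<phi> x}"

definition circle_integral :: "real \<Rightarrow> (real \<Rightarrow> 'a::{banach, second_countable_topology}) \<Rightarrow> 'a" where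
  "circle_integral L f = (LINT x:{0..L}|lborel. f x)"

definition Lq_norm :: "real \<Rightarrow> real \<Rightarrow> (real \<Rightarrow> complex) \<Rightarrow> real" where
  "Lq_norm L q f = (circle_integral L (\<lambda>x. cmod (f x) powr q)) powr (1 / q)"

definition fourier_mode :: "real \<Rightarrow> int \<Rightarrow> real \<Rightarrow> complex" where
  "fourier_mode L k x = of_real (L powr (-1/2)) * exp (2 * of_real pi * \<i> * of_int k * of_real x / of_real L)"

text \<open>The inner product is conjugate-linear in its first argument.\<close>

definition fourier_coeff :: "real \<Rightarrow> int \<Rightarrow> (real \<Rightarrow> complex) \<Rightarrow> complex" where
  "fourier_coeff L k f = circle_integral L (\<lambda>x. cnj (fourier_mode L k x) * f x)"

text \<open>Eigenvalue of \<open>m\<^sup>2 - \<Delta>\<close> on the \<open>k\<close>-th mode.\<close>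

definition eigval :: "real \<Rightarrow> real \<Rightarrow> int \<Rightarrow> real" where
  "eigval L m k = (2 * pi * of_int k / L)\<^sup>2 + m\<^sup>2"

text \<open>\<open>M\<close> is the centered Gaussian probability measure, on the Borel sets of the continuous
  functions on the circle, with covariance \<open>\<beta>\<^sup>-\<^sup>1 (m\<^sup>2 - \<Delta>)\<^sup>-\<^sup>1\<close>. The sigma algebra is generated by the
  Fourier coefficients, so their joint law determines \<open>M\<close>. The density is with
  respect to Lebesgue measure on the complex plane.\<close>

definition is_gaussian_measure ::
  "real \<Rightarrow> real \<Rightarrow> real \<Rightarrow> (real \<Rightarrow>\<^sub>C complex) measure \<Rightarrow> bool" where
  "is_gaussian_measure L m \<beta> M \<longleftrightarrow>
     prob_space M \<and>
     sets M = sets (restrict_space borel (circle_fun L)) \<and>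
     prob_space.indep_vars M (\<lambda>_. borel)
       (\<lambda>k \<phi>. fourier_coeff L k (apply_bcontfun \<phi>)) (UNIV :: int set) \<and>
     (\<forall>k. let \<theta> = \<beta> * eigval L m k in
        distributed M lborel (\<lambda>\<phi>. fourier_coeff L k (apply_bcontfun \<phi>))
          (\<lambda>z. ennreal (\<theta> / (2 * pi) * exp (- \<theta> * (cmod z)\<^sup>2 / 2))))"

text \<open>\<open>\<psi>\<close> represents \<open>(m\<^sup>2 - \<Delta>)\<^sup>\<gamma> \<phi>\<close>, i.e. it is the sum in \<open>L\<^sup>2\<close> of its Fourier series. Such a
  \<open>\<psi>\<close> is in \<open>L\<^sup>2\<close>, because the extended nonnegative integrals below tend to \<open>0\<close>, and is unique up
  to null sets.\<close>

definition is_elliptic_power :: "real \<Rightarrow> real \<Rightarrow> real \<Rightarrow> (real \<Rightarrow> complex) \<Rightarrow> (real \<Rightarrow> complex) \<Rightarrow> bool" where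
  "is_elliptic_power L m \<gamma> \<phi> \<psi> \<longleftrightarrow>
     \<psi> \<in> borel_measurable borel \<and>
     (\<lambda>N::nat. \<integral>\<^sup>+x\<in>{0..L}. ennreal ((cmod (\<psi> x -
         (\<Sum>k\<in>{- int N..int N}. of_real (eigval L m k powr \<gamma>) * fourier_coeff L k \<phi>
            * fourier_mode L k x)))\<^sup>2) \<partial>lborel) \<longlonglongrightarrow> 0"

text \<open>The value \<open>0\<close> off the domain of the operator is an arbitrary convention; for \<open>\<gamma> < 1/8\<close> it
  concerns a null set of the Gaussian measure only.\<close>

definition elliptic_power :: "real \<Rightarrow> real \<Rightarrow> real \<Rightarrow> (real \<Rightarrow> complex) \<Rightarrow> real \<Rightarrow> complex" where
  "elliptic_power L m \<gamma> \<phi> =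
     (if \<exists>\<psi>. is_elliptic_power L m \<gamma> \<phi> \<psi> then SOME \<psi>. is_elliptic_power L m \<gamma> \<phi> \<psi> else (\<lambda>_. 0))"

end

theory Submission
  imports Defs
begin

text \<open>Split the Fourier series of \<open>\<phi>\<close> into dyadic blocks \<open>2\<^sup>j\<^sup>-\<^sup>1 \<le> |k| < 2\<^sup>j\<close>. Under the Gaussian measure the squared
  \<open>L\<^sup>2\<close> norm of block \<open>j\<close> concentrates around \<open>2\<^sup>-\<^sup>j\<close> with tails \<open>exp (- c 4\<^sup>j t)\<close>, so almost surely it is at most
  \<open>K (2\<^sup>-\<^sup>j + 4\<^sup>-\<^sup>j G)\<close> for all \<open>j\<close> at once, with \<open>exp G\<close> integrable; only a union bound over \<open>j\<close> is needed,
  since \<open>exp (max\<^sub>j y\<^sub>j) \<le> \<Sum>\<^sub>j exp y\<^sub>j\<close>. The first term of the bound contributes a constant to every norm below \<open>H\<^sup>1\<^sup>/\<^sup>2\<close>; the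
  second behaves like a function of squared \<open>H\<^sup>1\<close> norm \<open>G\<close>, and interpolating it with \<open>N = \<parallel>\<phi>\<parallel>\<^sub>2\<close> bounds the
  interaction by \<open>C (1 + N\<^sup>a G\<^sup>b)\<close> with \<open>b < 1\<close>. By Young's inequality this is at most \<open>G + \<kappa> N\<^sup>2\<^sup>r + C'\<close> as soon as
  \<open>a / (1 - b) < 2 r\<close>. For (i) the exponents approach \<open>a = (p + 2) / 2\<close>, \<open>b = (p - 2) / 4\<close>, which gives the
  condition \<open>r > (p + 2) / (6 - p)\<close>, implied by the stated one.\<close>

section \<open>Inequalities for real powers\<close>

text \<open>The term 2^-j in the block bound stands for about 2^j independent modes of variance of
  order 4^-j. Weighted by 4^j it is not summable: typical functions lie outside H^1, so this part
  has to be split off before interpolating. Only the excess over it behaves like a squared H^1 norm,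
  and the Gaussian penalises it no faster than exponentially in G. Hence G may enter the interaction
  only to a power b < 1, and this is where p < 6 comes from: b = (p - 2) / 4 reaches 1 at p = 6. The
  remaining power of N is paid for by the term with \<kappa>. One random variable \<open>H\<close>
  with G = ln \<open>H\<close> serves for all blocks and norms, so in the end every integrand is
  dominated by a constant multiple of \<open>H\<close>. Part (ii) has a second obstacle:
  \<open>integrable\<close> includes measurability, while the elliptic power of \<phi> is picked by
  Hilbert choice for each \<phi> separately. The pairing is therefore reached as a limit of pairings
  with partial Fourier sums, which do not see that choice.\<close>

lemma powr_absorb:
  fixes A q q' \<kappa> :: real
  assumes "0 < q'" "q' < q" "0 \<le> A" "0 < \<kappa>"
  shows "\<exists>C\<ge>0. \<forall>x\<ge>0. A * x powr q' \<le> \<kappa> * x powr q + C"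
proof -
  \<comment> \<open>\<open>R\<close> is where \<open>A * x powr q'\<close> and
    \<open>\<kappa> * x powr q\<close> cross. Beyond it the larger power wins; up to it the left
    side is at most its value at \<open>R\<close>, which becomes the constant.\<close>
  define R where "R = (A / \<kappa>) powr (1 / (q - q'))"
  show ?thesis
  proof (intro exI[of _ "A * R powr q'"] conjI allI impI)
    show "0 \<le> A * R powr q'" using assms by simp
    fix x :: real assume x: "0 \<le> x"
    show "A * x powr q' \<le> \<kappa> * x powr q + A * R powr q'"
    proof (cases "x \<le> R")
      case True
      then have "A * x powr q' \<le> A * R powr q'"
        using assms x by (intro mult_left_mono powr_mono2) auto
      moreover have "0 \<le> \<kappa> * x powr q" using assms by simp
      ultimately show ?thesis by linarith
    next
      case False
      then have "R powr (q - q') \<le> x powr (q - q')"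
        using assms by (intro powr_mono2) (auto simp: R_def)
      moreover have "R powr (q - q') = A / \<kappa>"
        using assms by (simp add: R_def powr_powr)
      ultimately have "A \<le> \<kappa> * x powr (q - q')"
        using assms by (simp add: field_simps)
      then have "A * x powr q' \<le> \<kappa> * x powr (q - q') * x powr q'"
        by (intro mult_right_mono) auto
      also have "\<dots> = \<kappa> * x powr q" by (simp add: mult.assoc flip: powr_add)
      finally show ?thesis using assms by (simp add: add_increasing2)
    qed
  qed
qed

text \<open>Either the product is at most \<open>\<eta> * y\<close>, or the failed comparison bounds
  \<open>y powr (1 - b)\<close> by a multiple of \<open>x powr a\<close>. In the second case y can
  be eliminated, which leaves the single power a / (1 - b) of x for \<open>powr_absorb\<close>;
  \<open>A'\<close> is the coefficient produced by the elimination.\<close>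

lemma young_absorb:
  fixes A a b q \<eta> \<kappa> :: real
  assumes "0 < a" "0 < b" "b < 1" "a / (1 - b) < q" "0 \<le> A" "0 < \<eta>" "0 < \<kappa>"
  shows "\<exists>C\<ge>0. \<forall>x\<ge>0. \<forall>y\<ge>0. A * (x powr a * y powr b) \<le> \<eta> * y + \<kappa> * x powr q + C"
proof -
  define A' where "A' = A * (A / \<eta>) powr (b / (1 - b))"
  have "0 \<le> A'" using assms by (simp add: A'_def)
  then obtain C where C: "C \<ge> 0" "\<And>x. x \<ge> 0 \<Longrightarrow> A' * x powr (a / (1 - b)) \<le> \<kappa> * x powr q + C"
    using powr_absorb[of "a / (1 - b)" q A' \<kappa>] assms by auto
  show ?thesis
  proof (intro exI[of _ C] conjI allI impI)
    show "0 \<le> C" by fact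
    fix x y :: real assume x: "0 \<le> x" and y: "0 \<le> y"
    show "A * (x powr a * y powr b) \<le> \<eta> * y + \<kappa> * x powr q + C"
    proof (cases "A * (x powr a * y powr b) \<le> \<eta> * y")
      case True
      moreover have "0 \<le> \<kappa> * x powr q" using assms by simp
      ultimately show ?thesis using C(1) by linarith
    next
      case False
      \<comment> \<open>If x or y were 0 the product would be 0, as \<open>0 powr a = 0\<close>, and
        the other case would apply.\<close>
      have xy: "0 < x" "0 < y"
        using False x y assms by (auto simp: less_le intro: ccontr)
      have "\<eta> * y powr (1 - b) * y powr b < A * x powr a * y powr b"
        using False xy by (simp add: mult.assoc flip: powr_add)
      then have "y powr (1 - b) \<le> A / \<eta> * x powr a"
        using xy assms by (simp add: field_simps)
      then have "(y powr (1 - b)) powr (b / (1 - b)) \<le> (A / \<eta> * x powr a) powr (b / (1 - b))"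
        using assms by (intro powr_mono2) auto
      then have "y powr b \<le> (A / \<eta>) powr (b / (1 - b)) * x powr (a * b / (1 - b))"
        using assms xy unfolding powr_powr powr_mult by (simp add: powr_powr)
      then have "A * (x powr a * y powr b) \<le>
          A * (x powr a * ((A / \<eta>) powr (b / (1 - b)) * x powr (a * b / (1 - b))))"
        using assms by (intro mult_left_mono) auto
      also have "\<dots> = A' * x powr (a + a * b / (1 - b))"
        by (simp add: A'_def powr_add)
      also have "a + a * b / (1 - b) = a / (1 - b)"
        using assms by (simp add: field_simps)
      also have "A' * x powr (a / (1 - b)) \<le> \<kappa> * x powr q + C" using C(2) x by simp
      finally show ?thesis using mult_nonneg_nonneg[of \<eta> y] assms y by linarith
    qed
  qed
qed

text \<open>Where 1 / 2^j dominates, b_j^p is of order 2^(-j p / 2), and e < p / 2 leaves a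
  geometric series. Where G / 4^j dominates, only the fraction s of the exponent p is spent on that
  bound and the rest on b_j \<le> N; the decay is then 2^(-j p s), and e < p s suffices. The case
  may change with j, so the ratio \<open>q\<close> uses the smaller of the two margins.\<close>

lemma dyadic_sum_bound:
  fixes e p s K :: real
  assumes s: "0 < s" "s < 1" and "0 < p" "e < p / 2" "e < p * s" "0 \<le> K"
  shows "\<exists>C\<ge>0. \<forall>b N G J. 0 \<le> G \<longrightarrow>
      (\<forall>j::nat. 0 \<le> b j \<and> b j \<le> N \<and> (b j)\<^sup>2 \<le> K * (1 / 2 ^ j + G / 4 ^ j)) \<longrightarrow>
      (\<Sum>j<J. 2 powr (real j * e) * b j powr p) \<le> C * (1 + N powr (p * (1 - s)) * G powr (p * s / 2))"
proof -
  define d where "d = min (p / 2 - e) (p * s - e)"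
  have d: "d > 0" using assms by (simp add: d_def)
  define q where "q = 2 powr (- d)"
  have q: "0 < q" "q < 1" using d powr_less_mono[of "- d" 0 2] by (auto simp: q_def)
  define C0 where "C0 = (2 * K) powr (p / 2) + (2 * K) powr (p * s / 2)"
  have C0: "C0 \<ge> 0" by (simp add: C0_def)
  show ?thesis
  proof (intro exI[of _ "C0 / (1 - q)"] conjI allI impI)
    show "0 \<le> C0 / (1 - q)" using C0 q by simp
    fix b :: "nat \<Rightarrow> real" and N G :: real and J :: nat
    assume G: "0 \<le> G"
    assume "\<forall>j. 0 \<le> b j \<and> b j \<le> N \<and> (b j)\<^sup>2 \<le> K * (1 / 2 ^ j + G / 4 ^ j)"
    then have b: "0 \<le> b j" "b j \<le> N" "(b j)\<^sup>2 \<le> K * (1 / 2 ^ j + G / 4 ^ j)" for j by auto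
    define T where "T = 1 + N powr (p * (1 - s)) * G powr (p * s / 2)"
    have T: "T \<ge> 1" by (simp add: T_def)
    have sqr: "b j powr t = ((b j)\<^sup>2) powr (t / 2)" for j t
    proof (cases "b j = 0")
      case False
      then have "b j > 0" using b(1)[of j] by simp
      then show ?thesis by (simp add: powr_powr flip: powr_numeral)
    qed simp
    have main: "2 powr (real j * e) * b j powr p \<le> C0 * T * q ^ j" for j
    proof -
      have qj: "q ^ j = 2 powr (- (real j * d))"
        by (simp add: q_def powr_powr mult.commute flip: powr_realpow)
      consider "G / 4 ^ j \<le> 1 / 2 ^ j" | "1 / 2 ^ j < G / 4 ^ j" by linarith
      then have "b j powr p \<le> C0 * T * 2 powr (- (real j * min (p / 2) (p * s)))"
      proof cases
        case 1
        have "(b j)\<^sup>2 \<le> K * (1 / 2 ^ j + G / 4 ^ j)" by (rule b)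
        also have "\<dots> \<le> K * (1 / 2 ^ j + 1 / 2 ^ j)"
          using 1 assms by (intro mult_left_mono add_left_mono) auto
        also have "\<dots> = 2 * K * 2 powr (- real j)"
          by (simp add: powr_minus powr_realpow divide_inverse)
        finally have "b j powr p \<le> (2 * K * 2 powr (- real j)) powr (p / 2)"
          unfolding sqr[of j p] using assms by (intro powr_mono2) auto
        also have "\<dots> = (2 * K) powr (p / 2) * 2 powr (- (real j * (p / 2)))"
          using assms by (simp add: powr_mult powr_powr)
        also have "\<dots> \<le> (C0 * T) * 2 powr (- (real j * min (p / 2) (p * s)))"
        proof (rule mult_mono)
          have "(2 * K) powr (p / 2) \<le> C0 * 1" by (simp add: C0_def)
          also have "\<dots> \<le> C0 * T" using T C0 by (intro mult_left_mono) auto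
          finally show "(2 * K) powr (p / 2) \<le> C0 * T" .
          show "2 powr (- (real j * (p / 2))) \<le> 2 powr (- (real j * min (p / 2) (p * s)))"
            by (intro powr_mono le_imp_neg_le mult_left_mono) auto
        qed (use T C0 in auto)
        finally show ?thesis .
      next
        case 2
        have "(b j)\<^sup>2 \<le> K * (1 / 2 ^ j + G / 4 ^ j)" by (rule b)
        also have "\<dots> \<le> K * (G / 4 ^ j + G / 4 ^ j)"
          using 2 assms by (intro mult_left_mono add_right_mono) auto
        also have "\<dots> = 2 * K * (G * 2 powr (- 2 * real j))"
          by (simp add: powr_minus powr_realpow divide_inverse flip: powr_powr)
        finally have "b j powr (p * s) \<le> (2 * K * (G * 2 powr (- 2 * real j))) powr (p * s / 2)"
          unfolding sqr[of j "p * s"] using assms by (intro powr_mono2) auto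
        also have "\<dots> = (2 * K) powr (p * s / 2) * (G powr (p * s / 2) * 2 powr (- (real j * (p * s))))"
          using assms G by (simp add: powr_mult powr_powr mult_ac)
        finally have 1: "b j powr (p * s) \<le>
           (2 * K) powr (p * s / 2) * (G powr (p * s / 2) * 2 powr (- (real j * (p * s))))" .
        have "b j powr p = b j powr (p * (1 - s)) * b j powr (p * s)"
          by (simp add: algebra_simps flip: powr_add)
        also have "\<dots> \<le> N powr (p * (1 - s)) *
            ((2 * K) powr (p * s / 2) * (G powr (p * s / 2) * 2 powr (- (real j * (p * s)))))"
          using b assms by (intro mult_mono 1 powr_mono2) auto
        also have "\<dots> = ((2 * K) powr (p * s / 2) * (N powr (p * (1 - s)) * G powr (p * s / 2)))
            * 2 powr (- (real j * (p * s)))" by (simp add: mult_ac)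
        also have "\<dots> \<le> (C0 * T) * 2 powr (- (real j * min (p / 2) (p * s)))"
        proof (rule mult_mono)
          show "(2 * K) powr (p * s / 2) * (N powr (p * (1 - s)) * G powr (p * s / 2)) \<le> C0 * T"
            by (rule mult_mono) (auto simp: C0_def T_def)
          show "2 powr (- (real j * (p * s))) \<le> 2 powr (- (real j * min (p / 2) (p * s)))"
            by (intro powr_mono le_imp_neg_le mult_left_mono) auto
        qed (use T C0 in auto)
        finally show ?thesis .
      qed
      then have "2 powr (real j * e) * b j powr p \<le>
          2 powr (real j * e) * (C0 * T * 2 powr (- (real j * min (p / 2) (p * s))))"
        by (intro mult_left_mono) auto
      also have "\<dots> = C0 * T * (2 powr (real j * e) * 2 powr (- (real j * min (p / 2) (p * s))))"
        by (simp add: mult_ac)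
      also have "2 powr (real j * e) * 2 powr (- (real j * min (p / 2) (p * s))) = q ^ j"
        unfolding qj d_def by (auto simp: min_def algebra_simps simp flip: powr_add)
      finally show ?thesis .
    qed
    have "(\<Sum>j<J. 2 powr (real j * e) * b j powr p) \<le> (\<Sum>j<J. C0 * T * q ^ j)"
      by (intro sum_mono main)
    also have "\<dots> = C0 * T * (\<Sum>j<J. q ^ j)" by (simp add: sum_distrib_left)
    also have "(\<Sum>j<J. q ^ j) \<le> 1 / (1 - q)"
      using q sum_le_suminf[of "\<lambda>j. q ^ j" "{..<J}"] by (simp add: suminf_geometric summable_geometric)
    finally have "(\<Sum>j<J. 2 powr (real j * e) * b j powr p) \<le> C0 * T * (1 / (1 - q))"
      using C0 T by (simp add: mult_left_mono)
    then show "(\<Sum>j<J. 2 powr (real j * e) * b j powr p) \<le>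
        C0 / (1 - q) * (1 + N powr (p * (1 - s)) * G powr (p * s / 2))"
      by (simp add: T_def)
  qed
qed

text \<open>A substitute for Minkowski's inequality in \<open>L\<^sup>p\<close>: it costs only a geometric weight per block.\<close>

lemma powr_sum_weighted:
  fixes a w :: "nat \<Rightarrow> real"
  assumes "0 < p" "\<And>j. 0 \<le> a j" "\<And>j. 0 < w j" "(\<Sum>j<J. w j) \<le> W"
  shows "(\<Sum>j<J. a j) powr p \<le> W powr p * (\<Sum>j<J. (a j / w j) powr p)"
proof (cases "J = 0")
  case False
  \<comment> \<open>The sum is at most \<open>W\<close> times the largest ratio
    \<open>a j / w j\<close>, and the p-th power of a maximum is at most the sum of the p-th
    powers.\<close>
  define m where "m = Max ((\<lambda>j. a j / w j) ` {..<J})"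
  have "m \<in> (\<lambda>j. a j / w j) ` {..<J}"
    unfolding m_def using False by (intro Max_in) auto
  then obtain i where i: "i < J" "m = a i / w i" by auto
  have m0: "0 \<le> m" using assms i by (simp add: less_imp_le)
  have "a j \<le> w j * m" if "j < J" for j
  proof -
    have "a j / w j \<le> m" unfolding m_def using that by (intro Max_ge) auto
    then show ?thesis using assms(3)[of j] by (simp add: field_simps)
  qed
  then have "(\<Sum>j<J. a j) \<le> (\<Sum>j<J. w j * m)" by (intro sum_mono) auto
  also have "\<dots> \<le> W * m" using assms m0 by (simp flip: sum_distrib_right add: mult_right_mono)
  finally have "(\<Sum>j<J. a j) powr p \<le> (W * m) powr p"
    using assms by (intro powr_mono2 sum_nonneg) auto
  also have "\<dots> = W powr p * m powr p"
    using m0 assms(4) sum_nonneg[of "{..<J}" w] assms(3) by (intro powr_mult)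
  also have "m powr p \<le> (\<Sum>j<J. (a j / w j) powr p)"
    unfolding i(2) using i(1) by (intro member_le_sum) auto
  finally show ?thesis by (simp add: mult_left_mono)
qed simp

section \<open>Fourier series on the circle\<close>

text \<open>Both end points are kept: the interval is then compact, so continuous functions are
  integrable, and the point counted twice is a null set.\<close>

definition circle_measure :: "real \<Rightarrow> real measure" where
  "circle_measure L = restrict_space lborel {0..L}"

lemma measurable_circle_measure [measurable (raw)]:
  "f \<in> borel_measurable borel \<Longrightarrow> f \<in> borel_measurable (circle_measure L)"
  unfolding circle_measure_def by (intro measurable_restrict_space1) simp

lemma space_circle_measure [simp]: "space (circle_measure L) = {0..L}"
  by (simp add: circle_measure_def space_restrict_space)

lemma finite_measure_circle [simp]: "finite_measure (circle_measure L)"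
  by (rule finite_measureI) (simp add: circle_measure_def emeasure_restrict_space emeasure_lborel_Icc_eq)

lemma measure_circle: "L > 0 \<Longrightarrow> measure (circle_measure L) {0..L} = L"
  unfolding circle_measure_def by (subst measure_restrict_space) auto

lemma circle_integral_eq: "circle_integral L f = integral\<^sup>L (circle_measure L) f"
  unfolding circle_integral_def circle_measure_def set_lebesgue_integral_def
  by (subst integral_restrict_space) auto

lemma nn_integral_circle:
  "(\<integral>\<^sup>+x\<in>{0..L}. f x \<partial>lborel) = (\<integral>\<^sup>+x. f x \<partial>circle_measure L)"
  unfolding circle_measure_def by (subst nn_integral_restrict_space) (auto simp: mult.commute)

lemma integrable_circle:
  fixes f :: "real \<Rightarrow> 'a::euclidean_space"
  assumes "continuous_on UNIV f"
  shows "integrable (circle_measure L) f"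
proof -
  have "set_integrable lborel {0..L} f"
    using assms by (intro borel_integrable_atLeastAtMost') (auto intro: continuous_on_subset)
  then show ?thesis
    unfolding circle_measure_def set_integrable_def
    by (subst integrable_restrict_space) auto
qed

lemma continuous_fourier_mode [continuous_intros]:
  "continuous_on A f \<Longrightarrow> continuous_on A (\<lambda>x. fourier_mode L k (f x))"
  \<comment> \<open>For \<open>L = 0\<close> the quotient in the exponent is 0 by convention and the
    mode is constant.\<close>
  unfolding fourier_mode_def by (cases "L = 0") (auto intro!: continuous_intros)

lemma norm_fourier_mode: "cmod (fourier_mode L k x) = L powr (- 1 / 2)"
proof -
  have "2 * complex_of_real pi * \<i> * of_int k * of_real x / of_real L = \<i> * of_real (2 * pi * k * x / L)"
    by simp
  then show ?thesis unfolding fourier_mode_def by (simp only: norm_mult norm_exp_i_times) simp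
qed

lemma fourier_mode_mult:
  "fourier_mode L j x * fourier_mode L k x = of_real (L powr (- 1 / 2)) * fourier_mode L (j + k) x"
  unfolding fourier_mode_def by (simp add: algebra_simps add_divide_distrib flip: exp_add)

lemma cnj_fourier_mode: "cnj (fourier_mode L k x) = fourier_mode L (- k) x"
  unfolding fourier_mode_def by (simp add: exp_cnj)

lemma integral_fourier_mode:
  assumes "L > 0"
  shows "(\<integral>x. fourier_mode L k x \<partial>circle_measure L) = (if k = 0 then of_real (L powr (1 / 2)) else 0)"
proof (cases "k = 0")
  case True
  have "(\<integral>x. fourier_mode L k x \<partial>circle_measure L) = of_real (L * L powr (- 1 / 2))"
    using True assms by (simp add: fourier_mode_def measure_circle scaleR_conv_of_real)
  also have "L * L powr (- 1 / 2) = L powr (1 / 2)" using assms powr_add[of L 1 "- 1 / 2"] by simp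
  finally show ?thesis using True by simp
next
  case False
  define c where "c = 2 * complex_of_real pi * \<i> * of_int k / of_real L"
  have c: "c \<noteq> 0" using False assms by (simp add: c_def)
  have mode: "fourier_mode L k x = of_real (L powr (- 1 / 2)) * exp (c * of_real x)" for x
    by (simp add: fourier_mode_def c_def)
  have "has_bochner_integral lborel (\<lambda>x. indicator {0..L} x *\<^sub>R exp (c * of_real x))
      (exp (c * of_real L) / c - exp (c * of_real 0) / c)"
    using assms c
    by (intro has_bochner_integral_FTC_Icc)
      (auto intro!: continuous_intros derivative_eq_intros
        has_vector_derivative_real_field simp: field_simps)
  then have "(\<integral>x. exp (c * of_real x) \<partial>circle_measure L) = exp (c * of_real L) / c - exp (c * of_real 0) / c"
    unfolding circle_measure_def by (subst integral_restrict_space) (auto simp: has_bochner_integral_iff)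
  also have "c * of_real L = 2 * of_int k * of_real pi * \<i>"
    using assms by (simp add: c_def)
  also have "exp (2 * of_int k * complex_of_real pi * \<i>) = 1"
    using exp_integer_2pi[of "of_int k"] by (simp add: mult_ac)
  finally show ?thesis using False by (simp add: mode)
qed

lemma orthonormal_fourier_mode:
  assumes "L > 0"
  shows "(\<integral>x. cnj (fourier_mode L j x) * fourier_mode L k x \<partial>circle_measure L) = (if j = k then 1 else 0)"
proof -
  have "L powr (- 1 / 2) * L powr (1 / 2) = 1" using assms by (simp flip: powr_add)
  then have "complex_of_real (L powr (- 1 / 2)) * of_real (L powr (1 / 2)) = 1"
    by (simp only: of_real_1 flip: of_real_mult)
  then show ?thesis using assms by (simp add: cnj_fourier_mode fourier_mode_mult integral_fourier_mode)
qed

section \<open>Parseval, Bessel and the projection residual\<close>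

definition fourier_sum :: "real \<Rightarrow> int set \<Rightarrow> (int \<Rightarrow> complex) \<Rightarrow> real \<Rightarrow> complex" where
  "fourier_sum L K c x = (\<Sum>k\<in>K. c k * fourier_mode L k x)"

lemma continuous_fourier_sum [continuous_intros]:
  "continuous_on A f \<Longrightarrow> continuous_on A (\<lambda>x. fourier_sum L K c (f x))"
  unfolding fourier_sum_def by (intro continuous_intros)

lemma borel_measurable_fourier_sum [measurable]: "fourier_sum L K c \<in> borel_measurable borel"
  by (intro borel_measurable_continuous_onI continuous_intros)

lemma fourier_coeff_eq:
  "fourier_coeff L k f = (\<integral>x. cnj (fourier_mode L k x) * f x \<partial>circle_measure L)"
  by (simp add: fourier_coeff_def circle_integral_eq)

lemma integral_cnj_fourier_sum:
  assumes "continuous_on UNIV h"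
  shows "(\<integral>x. cnj (fourier_sum L K c x) * h x \<partial>circle_measure L) = (\<Sum>k\<in>K. cnj (c k) * fourier_coeff L k h)"
proof -
  have "integrable (circle_measure L) (\<lambda>x. cnj (fourier_mode L k x) * h x)" for k
    using assms by (intro integrable_circle continuous_intros)
  then show ?thesis
    by (simp add: fourier_sum_def sum_distrib_right mult.assoc fourier_coeff_eq Bochner_Integration.integral_sum)
qed

lemma fourier_coeff_fourier_sum:
  assumes "L > 0" "finite K"
  shows "fourier_coeff L j (fourier_sum L K c) = (if j \<in> K then c j else 0)"
proof -
  have "integrable (circle_measure L) (\<lambda>x. cnj (fourier_mode L j x) * fourier_mode L k x)" for k
    by (intro integrable_circle continuous_intros)
  then have "fourier_coeff L j (fourier_sum L K c) =
      (\<Sum>k\<in>K. c k * (\<integral>x. cnj (fourier_mode L j x) * fourier_mode L k x \<partial>circle_measure L))"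
    by (simp add: fourier_sum_def sum_distrib_left fourier_coeff_eq Bochner_Integration.integral_sum
        mult.left_commute[of _ "c _"])
  also have "\<dots> = (\<Sum>k\<in>K. if j = k then c k else 0)"
    using assms by (intro sum.cong) (auto simp: orthonormal_fourier_mode)
  finally show ?thesis using assms by simp
qed

lemma parseval_fourier_sum:
  assumes "L > 0" "finite K"
  shows "(\<integral>x. (cmod (fourier_sum L K c x))\<^sup>2 \<partial>circle_measure L) = (\<Sum>k\<in>K. (cmod (c k))\<^sup>2)"
proof -
  have "complex_of_real (\<integral>x. (cmod (fourier_sum L K c x))\<^sup>2 \<partial>circle_measure L) =
      (\<integral>x. cnj (fourier_sum L K c x) * fourier_sum L K c x \<partial>circle_measure L)"
    by (simp only: complex_norm_square mult.commute flip: integral_complex_of_real)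
  also have "\<dots> = of_real (\<Sum>k\<in>K. (cmod (c k))\<^sup>2)"
    using assms by (subst integral_cnj_fourier_sum)
      (auto simp: fourier_coeff_fourier_sum complex_norm_square mult.commute simp del: of_real_power
        intro!: continuous_intros)
  finally show ?thesis by (simp only: of_real_eq_iff)
qed

text \<open>Pythagoras: with the coefficients of \<open>h\<close> itself, the inner product of
  \<open>h\<close> with the sum equals the squared norm of the sum, so expanding the square adds
  that norm once and subtracts it twice.\<close>

lemma integral_residual:
  assumes "L > 0" "finite K" "continuous_on UNIV h"
  shows "(\<integral>x. (cmod (h x - fourier_sum L K (\<lambda>k. fourier_coeff L k h) x))\<^sup>2 \<partial>circle_measure L) =
    (\<integral>x. (cmod (h x))\<^sup>2 \<partial>circle_measure L) - (\<Sum>k\<in>K. (cmod (fourier_coeff L k h))\<^sup>2)"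
proof -
  define S where "S = fourier_sum L K (\<lambda>k. fourier_coeff L k h)"
  have S [continuous_intros]: "continuous_on UNIV S" unfolding S_def by (intro continuous_intros)
  note [continuous_intros] = assms(3)
  have int: "integrable (circle_measure L) (\<lambda>x. (cmod (h x))\<^sup>2)"
    "integrable (circle_measure L) (\<lambda>x. (cmod (S x))\<^sup>2)"
    "integrable (circle_measure L) (\<lambda>x. cnj (S x) * h x)"
    by (intro integrable_circle continuous_intros)+
  have eq: "(cmod (h x - S x))\<^sup>2 = (cmod (h x))\<^sup>2 + (cmod (S x))\<^sup>2 - 2 * Re (cnj (S x) * h x)" for x
    unfolding cmod_power2 by (simp add: algebra_simps power2_eq_square)
  have "(\<integral>x. (cmod (h x - S x))\<^sup>2 \<partial>circle_measure L) =
     (\<integral>x. (cmod (h x))\<^sup>2 \<partial>circle_measure L) + (\<integral>x. (cmod (S x))\<^sup>2 \<partial>circle_measure L)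
     - 2 * Re (\<integral>x. cnj (S x) * h x \<partial>circle_measure L)"
    unfolding eq using int integrable_Re[OF int(3)] integral_Re[OF int(3)]
    by (simp del: times_complex.sel)
  also have "(\<integral>x. cnj (S x) * h x \<partial>circle_measure L) = of_real (\<Sum>k\<in>K. (cmod (fourier_coeff L k h))\<^sup>2)"
    unfolding S_def using assms
    by (subst integral_cnj_fourier_sum) (auto simp: complex_norm_square mult.commute simp del: of_real_power)
  also have "(\<integral>x. (cmod (S x))\<^sup>2 \<partial>circle_measure L) = (\<Sum>k\<in>K. (cmod (fourier_coeff L k h))\<^sup>2)"
    unfolding S_def using assms by (intro parseval_fourier_sum) auto
  finally show ?thesis by (simp add: S_def)
qed

lemma bessel_inequality:
  assumes "L > 0" "finite K" "continuous_on UNIV h"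
  shows "(\<Sum>k\<in>K. (cmod (fourier_coeff L k h))\<^sup>2) \<le> (\<integral>x. (cmod (h x))\<^sup>2 \<partial>circle_measure L)"
proof -
  have "0 \<le> (\<integral>x. (cmod (h x - fourier_sum L K (\<lambda>k. fourier_coeff L k h) x))\<^sup>2 \<partial>circle_measure L)"
    by (intro integral_nonneg_AE) auto
  then show ?thesis using integral_residual[OF assms] by simp
qed

section \<open>Trigonometric polynomials and their uniform density\<close>

inductive trig_polynomial :: "real \<Rightarrow> (real \<Rightarrow> complex) \<Rightarrow> bool" for L where
  mode: "trig_polynomial L (fourier_mode L k)"
| scale: "trig_polynomial L f \<Longrightarrow> trig_polynomial L (\<lambda>x. c * f x)"
| add: "trig_polynomial L f \<Longrightarrow> trig_polynomial L g \<Longrightarrow> trig_polynomial L (\<lambda>x. f x + g x)"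

lemma trig_polynomial_mult:
  assumes "trig_polynomial L f" "trig_polynomial L g"
  shows "trig_polynomial L (\<lambda>x. f x * g x)"
  using assms(1)
proof induction
  case (mode j)
  show ?case using assms(2)
  proof induction
    case (mode k)
    show ?case unfolding fourier_mode_mult by (intro trig_polynomial.intros)
  next
    case (scale f c)
    from trig_polynomial.scale[OF this(2), of c] show ?case by (simp add: mult_ac)
  next
    case (add f g)
    from trig_polynomial.add[OF add(3,4)] show ?case by (simp add: algebra_simps)
  qed
next
  case (scale f c)
  from trig_polynomial.scale[OF this(2), of c] show ?case by (simp add: mult_ac)
next
  case (add f h)
  from trig_polynomial.add[OF add(3,4)] show ?case by (simp add: algebra_simps)
qed

lemma trig_polynomial_const:
  assumes "L > 0" shows "trig_polynomial L (\<lambda>x. c)"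
proof -
  have "trig_polynomial L (\<lambda>x. c * of_real (L powr (1 / 2)) * fourier_mode L 0 x)"
    by (intro trig_polynomial.intros)
  also have "(\<lambda>x. c * of_real (L powr (1 / 2)) * fourier_mode L 0 x) = (\<lambda>x. c)"
    using assms by (simp add: fourier_mode_def mult.assoc flip: of_real_mult powr_add)
  finally show ?thesis .
qed

lemma trig_polynomial_exp:
  assumes "L > 0"
  shows "trig_polynomial L (\<lambda>x. exp (\<i> * of_real (2 * pi * of_int k * x / L)))"
proof -
  have "trig_polynomial L (\<lambda>x. of_real (L powr (1 / 2)) * fourier_mode L k x)"
    by (intro trig_polynomial.intros)
  also have "(\<lambda>x. of_real (L powr (1 / 2)) * fourier_mode L k x) =
      (\<lambda>x. exp (\<i> * of_real (2 * pi * of_int k * x / L)))"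
  proof
    fix x
    have "L powr (1 / 2) * L powr (- 1 / 2) = 1" using assms by (simp flip: powr_add)
    then have "complex_of_real (L powr (1 / 2)) * of_real (L powr (- 1 / 2)) = 1"
      by (simp only: of_real_1 flip: of_real_mult)
    then show "of_real (L powr (1 / 2)) * fourier_mode L k x = exp (\<i> * of_real (2 * pi * of_int k * x / L))"
      unfolding fourier_mode_def mult.assoc[symmetric] by (simp add: mult_ac)
  qed
  finally show ?thesis .
qed

lemma continuous_trig_polynomial: "trig_polynomial L f \<Longrightarrow> continuous_on UNIV f"
  by (induction rule: trig_polynomial.induct) (auto intro!: continuous_intros)

text \<open>On the unit circle Re z = (z + 1/z) / 2 and Im z = (z - 1/z) / (2i), so a real linear
  functional is a combination of the modes 1 and -1. Real polynomial functions arise from these and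
  constants by sums and products.\<close>

lemma trig_polynomial_real_polynomial:
  assumes L: "L > 0" and "real_polynomial_function p"
  shows "trig_polynomial L (\<lambda>x. of_real (p (exp (\<i> * of_real (2 * pi * x / L)))))"
  using assms(2)
proof induction
  case (linear f)
  interpret f: bounded_linear f by fact
  let ?e = "\<lambda>k::int. \<lambda>x. exp (\<i> * of_real (2 * pi * of_int k * x / L))"
  have lin: "f z = Re z * f 1 + Im z * f \<i>" for z
  proof -
    have "z = Re z *\<^sub>R 1 + Im z *\<^sub>R \<i>" by (simp add: complex_eq_iff)
    then show ?thesis using f.add f.scaleR by (metis real_scaleR_def)
  qed
  have "complex_of_real (f (exp (\<i> * of_real (2 * pi * x / L)))) =
      (of_real (f 1) / 2 + of_real (f \<i>) / (2 * \<i>)) * ?e 1 x +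
      (of_real (f 1) / 2 - of_real (f \<i>) / (2 * \<i>)) * ?e (- 1) x" for x
  proof -
    define t where "t = 2 * pi * x / L"
    have "?e 1 x = cis t" "?e (- 1) x = cis (- t)"
      by (simp_all add: cis_conv_exp t_def)
    moreover have "exp (\<i> * of_real (2 * pi * x / L)) = cis t" by (simp add: cis_conv_exp t_def)
    ultimately show ?thesis
      by (simp only: lin[of "cis t"]) (simp add: complex_eq_iff field_simps)
  qed
  then show ?case
    by (simp only:) (intro trig_polynomial.add trig_polynomial.scale trig_polynomial_exp L)
next
  case (const c) show ?case by (intro trig_polynomial_const L)
next
  case (add f g) then show ?case by (simp add: trig_polynomial.add)
next
  case (mult f g) then show ?case by (simp add: trig_polynomial_mult)
qed

lemma periodic_int:
  fixes \<phi> :: "real \<Rightarrow> 'a"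
  assumes "\<And>x. \<phi> (x + L) = \<phi> x"
  shows "\<phi> (x + of_int n * L) = \<phi> x"
proof (induction n rule: int_induct[where k = 0])
  case (step1 i) then show ?case using assms[of "x + of_int i * L"] by (simp add: algebra_simps)
next
  case (step2 i) then show ?case using assms[of "x + of_int (i - 1) * L"] by (simp add: algebra_simps)
qed simp

text \<open>The function is transported to the unit circle of the plane, where Stone-Weierstrass
  gives polynomials in the real coordinates. The Fourier sums of a continuous function need not
  converge uniformly, hence the detour through arbitrary trigonometric polynomials.\<close>

lemma trig_polynomial_dense:
  assumes L: "L > 0" and cont: "continuous_on UNIV \<phi>" and per: "\<And>x. \<phi> (x + L) = \<phi> x" and "e > 0"
  obtains f where "trig_polynomial L f" "\<And>x. cmod (\<phi> x - f x) < e"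
proof -
  \<comment> \<open>Angles with the same exponential differ by a multiple of 2 pi, hence the points
    by whole periods: the choice of an argument does not matter.\<close>
  have arg: "\<phi> (L * a / (2 * pi)) = \<phi> (L * b / (2 * pi))"
    if ab: "exp (\<i> * of_real a) = exp (\<i> * of_real b)" for a b
  proof -
    obtain n :: int where "\<i> * of_real a = \<i> * of_real b + (of_int (2 * n) * pi) * \<i>"
      using ab unfolding exp_eq by blast
    then have "a = b + 2 * n * pi" by (simp add: complex_eq_iff)
    then have "L * a / (2 * pi) = L * b / (2 * pi) + of_int n * L" by (simp add: field_simps)
    then show ?thesis using periodic_int[of \<phi> L, OF per] by simp
  qed
  have c\<phi>: "isCont \<phi> x" for x using cont by (simp add: continuous_on_eq_continuous_at)
  define F where "F z = \<phi> (L * Arg z / (2 * pi))" for z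
  \<comment> \<open>a second formula, needed for continuity across the branch cut of \<^const>\<open>Arg\<close>\<close>
  have F': "F z = \<phi> (L * (Arg (- z) + pi) / (2 * pi))" if "z \<noteq> 0" for z
    unfolding F_def
  proof (rule arg)
    have "of_real (cmod z) * exp (\<i> * of_real (Arg z)) = z"
      using Arg_eq[of z] that by simp
    moreover have "of_real (cmod z) * exp (\<i> * of_real (Arg (- z))) = - z"
      using Arg_eq[of "- z"] that by simp
    moreover have "exp (\<i> * of_real (Arg (- z) + pi)) = - exp (\<i> * of_real (Arg (- z)))"
      by (simp add: algebra_simps exp_add)
    ultimately have "of_real (cmod z) * exp (\<i> * of_real (Arg z)) =
        of_real (cmod z) * exp (\<i> * of_real (Arg (- z) + pi))"
      by simp
    then show "exp (\<i> * of_real (Arg z)) = exp (\<i> * of_real (Arg (- z) + pi))"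
      using that by simp
  qed
  have F_exp: "F (exp (\<i> * of_real (2 * pi * x / L))) = \<phi> x" for x
  proof -
    let ?z = "exp (\<i> * of_real (2 * pi * x / L))"
    have "exp (\<i> * of_real (Arg ?z)) = exp (\<i> * of_real (2 * pi * x / L))"
      using Arg_eq[of ?z] by (simp add: norm_exp_i_times del: of_real_divide of_real_mult)
    from arg[OF this] show ?thesis using L by (simp add: F_def)
  qed
  \<comment> \<open>\<open>F\<close> is constant along rays, so continuity on the circle can be
    proved pointwise in the punctured plane.\<close>
  have cF: "isCont F z" if "z \<noteq> 0" for z
  proof (cases "z \<in> \<real>\<^sub>\<le>\<^sub>0")
    case False
    then have "isCont (\<lambda>w. L * Arg w / (2 * pi)) z"
      by (intro continuous_intros continuous_at_Arg) auto
    then show ?thesis unfolding F_def by (rule isCont_o2) (rule c\<phi>)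
  next
    case True
    then have "- z \<notin> \<real>\<^sub>\<le>\<^sub>0" using that by (auto simp: complex_nonpos_Reals_iff complex_eq_iff)
    then have "isCont (\<lambda>w. Arg (- w)) z"
      by (intro isCont_o2[of z "\<lambda>w. - w" Arg] continuous_at_Arg continuous_intros)
    then have "isCont (\<lambda>w. L * (Arg (- w) + pi) / (2 * pi)) z"
      by (intro continuous_intros) auto
    then have "isCont (\<lambda>z. \<phi> (L * (Arg (- z) + pi) / (2 * pi))) z"
      by (rule isCont_o2) (rule c\<phi>)
    moreover have "\<forall>\<^sub>F w in nhds z. F w = \<phi> (L * (Arg (- w) + pi) / (2 * pi))"
      using that by (intro eventually_mono[OF t1_space_nhds[of z 0]] F') auto
    ultimately show ?thesis by (simp add: isCont_cong)
  qed
  have "continuous_on (sphere 0 1) F"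
    by (intro continuous_at_imp_continuous_on) (auto intro!: cF)
  from Stone_Weierstrass_polynomial_function[OF _ this \<open>e > 0\<close>]
  obtain g where g: "polynomial_function g" "\<And>z. z \<in> sphere 0 1 \<Longrightarrow> cmod (F z - g z) < e"
    by auto
  have "real_polynomial_function (\<lambda>z. Re (g z))" "real_polynomial_function (\<lambda>z. Im (g z))"
    using g(1) bounded_linear_Re bounded_linear_Im unfolding polynomial_function_def
    by (force simp: o_def)+
  note 1 = this[THEN trig_polynomial_real_polynomial[OF L]]
  define E where "E = (\<lambda>x. exp (\<i> * of_real (2 * pi * x / L)))"
  have "trig_polynomial L (\<lambda>x. of_real (Re (g (E x))) + \<i> * of_real (Im (g (E x))))"
    unfolding E_def using 1 by (intro trig_polynomial.add trig_polynomial.scale)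
  then have 1: "trig_polynomial L (\<lambda>x. g (E x))" by (simp only: complex_eq[symmetric])
  have "cmod (\<phi> x - g (E x)) < e" for x
    using g(2)[of "E x"] F_exp[of x] by (simp add: E_def norm_exp_i_times del: of_real_divide of_real_mult)
  with 1 show ?thesis by (rule that)
qed

section \<open>Mean-square convergence of Fourier series\<close>

lemma fourier_coeff_scale: "fourier_coeff L k (\<lambda>x. c * f x) = c * fourier_coeff L k f"
  by (simp add: fourier_coeff_eq mult.left_commute[of _ c])

lemma fourier_coeff_add:
  assumes "continuous_on UNIV f" "continuous_on UNIV g"
  shows "fourier_coeff L k (\<lambda>x. f x + g x) = fourier_coeff L k f + fourier_coeff L k g"
proof -
  have "integrable (circle_measure L) (\<lambda>x. cnj (fourier_mode L k x) * f x)"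
    "integrable (circle_measure L) (\<lambda>x. cnj (fourier_mode L k x) * g x)"
    using assms by (auto intro!: integrable_circle continuous_intros)
  then show ?thesis by (simp add: fourier_coeff_eq algebra_simps)
qed

text \<open>Stated for every finite superset of a window: this survives addition by enlarging the
  window, and it later covers dyadic balls.\<close>

lemma fourier_sum_trig_polynomial:
  assumes L: "L > 0" and "trig_polynomial L f"
  shows "\<exists>n::nat. \<forall>K. finite K \<longrightarrow> {- int n..int n} \<subseteq> K \<longrightarrow> fourier_sum L K (\<lambda>k. fourier_coeff L k f) = f"
  using assms(2)
proof induction
  case (mode j)
  have "fourier_sum L K (\<lambda>k. fourier_coeff L k (fourier_mode L j)) = fourier_mode L j"
    if "finite K" "{- int (nat \<bar>j\<bar>)..int (nat \<bar>j\<bar>)} \<subseteq> K" for K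
  proof -
    have "j \<in> {- int (nat \<bar>j\<bar>)..int (nat \<bar>j\<bar>)}" by (auto simp: abs_if)
    with that(2) have "j \<in> K" by blast
    moreover have "fourier_coeff L k (fourier_mode L j) = (if k = j then 1 else 0)" for k
      using L by (simp add: fourier_coeff_eq orthonormal_fourier_mode)
    ultimately show ?thesis using that(1)
      by (auto simp: fourier_sum_def fun_eq_iff if_distrib[of "\<lambda>t. t * _"] cong: if_cong)
  qed
  then show ?case by blast
next
  case (scale f c)
  then obtain n :: nat where n: "\<And>K. finite K \<Longrightarrow> {- int n..int n} \<subseteq> K \<Longrightarrow>
      fourier_sum L K (\<lambda>k. fourier_coeff L k f) = f" by blast
  have "fourier_sum L K (\<lambda>k. fourier_coeff L k (\<lambda>x. c * f x)) =
      (\<lambda>x. c * fourier_sum L K (\<lambda>k. fourier_coeff L k f) x)" for K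
    by (simp add: fourier_coeff_scale fourier_sum_def fun_eq_iff mult.assoc sum_distrib_left)
  then show ?case by (intro exI[of _ n] allI impI) (simp add: n)
next
  case (add f g)
  obtain n1 n2 :: nat where
    "\<And>K. finite K \<Longrightarrow> {- int n1..int n1} \<subseteq> K \<Longrightarrow> fourier_sum L K (\<lambda>k. fourier_coeff L k f) = f"
    "\<And>K. finite K \<Longrightarrow> {- int n2..int n2} \<subseteq> K \<Longrightarrow> fourier_sum L K (\<lambda>k. fourier_coeff L k g) = g"
    using add by blast
  note n = this
  have fg: "continuous_on UNIV f" "continuous_on UNIV g" using add continuous_trig_polynomial by auto
  show ?case
  proof (intro exI[of _ "max n1 n2"] allI impI)
    fix K :: "int set" assume K: "finite K" "{- int (max n1 n2)..int (max n1 n2)} \<subseteq> K"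
    have "{- int n1..int n1} \<subseteq> {- int (max n1 n2)..int (max n1 n2)}"
      "{- int n2..int n2} \<subseteq> {- int (max n1 n2)..int (max n1 n2)}" by auto
    with K(2) have "{- int n1..int n1} \<subseteq> K" "{- int n2..int n2} \<subseteq> K" by blast+
    with n K(1) have "fourier_sum L K (\<lambda>k. fourier_coeff L k f) = f"
      "fourier_sum L K (\<lambda>k. fourier_coeff L k g) = g" by blast+
    then show "fourier_sum L K (\<lambda>k. fourier_coeff L k (\<lambda>x. f x + g x)) = (\<lambda>x. f x + g x)"
      using fg by (auto simp: fourier_coeff_add fourier_sum_def fun_eq_iff algebra_simps sum.distrib)
  qed
qed

text \<open>A large partial sum reproduces the approximating polynomial f exactly, so \<phi> and
  \<phi> - f have the same residual. By Bessel it is at most the squared norm of \<phi> - f, hence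
  at most L d^2, and d is chosen to make this e.\<close>

lemma fourier_sum_L2_approx:
  assumes L: "L > 0" and cont: "continuous_on UNIV \<phi>" and per: "\<And>x. \<phi> (x + L) = \<phi> x" and e: "e > 0"
  shows "\<exists>n::nat. \<forall>K. finite K \<longrightarrow> {- int n..int n} \<subseteq> K \<longrightarrow>
    (\<integral>x. (cmod (\<phi> x - fourier_sum L K (\<lambda>k. fourier_coeff L k \<phi>) x))\<^sup>2 \<partial>circle_measure L) \<le> e"
proof -
  define d where "d = sqrt (e / L)"
  have d: "d > 0" "L * d\<^sup>2 = e" using e L by (auto simp: d_def)
  obtain f where f: "trig_polynomial L f" "\<And>x. cmod (\<phi> x - f x) < d"
    using trig_polynomial_dense[OF L cont per d(1)] by blast
  obtain n :: nat where n: "\<And>K. finite K \<Longrightarrow> {- int n..int n} \<subseteq> K \<Longrightarrow>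
      fourier_sum L K (\<lambda>k. fourier_coeff L k f) = f"
    using fourier_sum_trig_polynomial[OF L f(1)] by blast
  have cf: "continuous_on UNIV f" by (rule continuous_trig_polynomial[OF f(1)])
  define h where "h = (\<lambda>x. \<phi> x + (- 1) * f x)"
  have ch: "continuous_on UNIV h" unfolding h_def by (intro continuous_intros cont cf)
  show ?thesis
  proof (intro exI[of _ n] allI impI)
    fix K :: "int set" assume K: "finite K" "{- int n..int n} \<subseteq> K"
    have "fourier_coeff L k h = fourier_coeff L k \<phi> - fourier_coeff L k f" for k
      unfolding h_def using cont cf
      by (subst fourier_coeff_add) (auto intro!: continuous_intros simp: fourier_coeff_scale[of L k "- 1", simplified])
    then have "fourier_sum L K (\<lambda>k. fourier_coeff L k h) x =
        fourier_sum L K (\<lambda>k. fourier_coeff L k \<phi>) x - f x" for x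
      using fun_cong[OF n[OF K], of x] by (simp add: fourier_sum_def left_diff_distrib sum_subtractf)
    then have "(\<integral>x. (cmod (\<phi> x - fourier_sum L K (\<lambda>k. fourier_coeff L k \<phi>) x))\<^sup>2 \<partial>circle_measure L) =
      (\<integral>x. (cmod (h x - fourier_sum L K (\<lambda>k. fourier_coeff L k h) x))\<^sup>2 \<partial>circle_measure L)"
      by (simp add: h_def)
    also have "\<dots> \<le> (\<integral>x. (cmod (h x))\<^sup>2 \<partial>circle_measure L)"
      unfolding integral_residual[OF L K(1) ch] by (simp add: sum_nonneg)
    also have "\<dots> \<le> (\<integral>x. d\<^sup>2 \<partial>circle_measure L)"
      using less_imp_le[OF f(2)] by (intro integral_mono integrable_circle continuous_intros ch)
        (auto simp: h_def intro!: power_mono)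
    also have "\<dots> = e" using L d by (simp add: measure_circle)
    finally show "(\<integral>x. (cmod (\<phi> x - fourier_sum L K (\<lambda>k. fourier_coeff L k \<phi>) x))\<^sup>2 \<partial>circle_measure L) \<le> e" .
  qed
qed

section \<open>Dyadic blocks and Lebesgue norms\<close>

text \<open>Cauchy-Schwarz against the constant 1, obtained from the nonnegative variance of |f|
  about its mean a / L. Square integrability is the only regularity available for the L^2 limits to
  which this is applied.\<close>

lemma integral_abs_squared_le:
  fixes f :: "real \<Rightarrow> complex"
  assumes L: "L > 0" and [measurable]: "f \<in> borel_measurable (circle_measure L)"
    and int: "integrable (circle_measure L) (\<lambda>x. (cmod (f x))\<^sup>2)"
  shows "integrable (circle_measure L) f"
    "(\<integral>x. cmod (f x) \<partial>circle_measure L)\<^sup>2 \<le> L * (\<integral>x. (cmod (f x))\<^sup>2 \<partial>circle_measure L)"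
proof -
  interpret finite_measure "circle_measure L" by simp
  have "cmod (f x) \<le> 1 + (cmod (f x))\<^sup>2" for x
    using zero_le_power2[of "cmod (f x) - 1"] norm_ge_zero[of "f x"]
    unfolding power2_diff by (simp del: norm_ge_zero)
  then have "cmod (f x) \<le> norm (1 + (cmod (f x))\<^sup>2)" for x by simp
  then show f: "integrable (circle_measure L) f"
    by (intro Bochner_Integration.integrable_bound[OF Bochner_Integration.integrable_add[OF integrable_const[of 1] int]]) auto
  define a where "a = (\<integral>x. cmod (f x) \<partial>circle_measure L)"
  have "0 \<le> (\<integral>x. (cmod (f x) - a / L)\<^sup>2 \<partial>circle_measure L)" by simp
  also have "\<dots> = (\<integral>x. (cmod (f x))\<^sup>2 - 2 * (a / L) * cmod (f x) + (a / L)\<^sup>2 \<partial>circle_measure L)"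
    by (rule Bochner_Integration.integral_cong) (simp_all add: power2_diff algebra_simps)
  also have "\<dots> = (\<integral>x. (cmod (f x))\<^sup>2 \<partial>circle_measure L) - 2 * (a / L) * a + L * (a / L)\<^sup>2"
    using f int L by (simp add: a_def measure_circle)
  also have "\<dots> = (\<integral>x. (cmod (f x))\<^sup>2 \<partial>circle_measure L) - a\<^sup>2 / L"
    using L by (simp add: field_simps power2_eq_square)
  finally show "(\<integral>x. cmod (f x) \<partial>circle_measure L)\<^sup>2 \<le> L * (\<integral>x. (cmod (f x))\<^sup>2 \<partial>circle_measure L)"
    using L unfolding a_def by (simp add: field_simps)
qed

text \<open>The zero mode has block 0 to itself, so block j > 0 holds the frequencies from 2^(j-1)
  up to but excluding 2^j, and the eigenvalues in block j are comparable to 4^j for every j.\<close>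

primrec dyadic_block :: "nat \<Rightarrow> int set" where
  "dyadic_block 0 = {0}"
| "dyadic_block (Suc j) = {k. 2 ^ j \<le> \<bar>k\<bar> \<and> \<bar>k\<bar> < 2 ^ Suc j}"

definition dyadic_ball :: "nat \<Rightarrow> int set" where
  "dyadic_ball J = {k. \<bar>k\<bar> < 2 ^ J}"

lemma finite_dyadic_ball [simp]: "finite (dyadic_ball J)"
  by (rule finite_subset[of _ "{- (2 ^ J)..2 ^ J}"]) (auto simp: dyadic_ball_def)

lemma dyadic_block_subset: "dyadic_block j \<subseteq> dyadic_ball j"
  by (cases j) (auto simp: dyadic_ball_def)

lemma finite_dyadic_block [simp]: "finite (dyadic_block j)"
  using finite_subset[OF dyadic_block_subset] by simp

lemma card_dyadic_block: "card (dyadic_block j) \<le> 2 ^ (j + 1)"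
proof -
  have "dyadic_ball j = {- (2 ^ j) <..< 2 ^ j}"
    by (auto simp: dyadic_ball_def abs_less_iff)
  then have "dyadic_block j \<subseteq> {- (2 ^ j) <..< 2 ^ j}" using dyadic_block_subset[of j] by simp
  then have "card (dyadic_block j) \<le> card {- (2 ^ j) <..< (2 ^ j :: int)}" by (intro card_mono) auto
  also have "\<dots> \<le> 2 ^ (j + 1)" by (simp add: nat_le_iff)
  finally show ?thesis .
qed

text \<open>The frequencies below 2^J fill the blocks 0 to J, which makes \<open>Suc J\<close>
  blocks because of the separate zero mode.\<close>

lemma sum_dyadic_ball: "(\<Sum>k\<in>dyadic_ball J. f k) = (\<Sum>j<Suc J. \<Sum>k\<in>dyadic_block j. f k)"
proof (induction J)
  case 0
  have "dyadic_ball 0 = {0}" by (auto simp: dyadic_ball_def)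
  then show ?case by simp
next
  case (Suc J)
  have "dyadic_ball (Suc J) = dyadic_ball J \<union> dyadic_block (Suc J)"
    by (auto simp: dyadic_ball_def)
  moreover have "dyadic_ball J \<inter> dyadic_block (Suc J) = {}" by (auto simp: dyadic_ball_def)
  ultimately show ?case using Suc by (simp add: sum.union_disjoint del: dyadic_block.simps)
qed

lemma fourier_sum_dyadic_ball:
  "fourier_sum L (dyadic_ball J) c x = (\<Sum>j<Suc J. fourier_sum L (dyadic_block j) c x)"
  unfolding fourier_sum_def by (rule sum_dyadic_ball)

lemma subset_dyadic_ball: "\<exists>J0. \<forall>J\<ge>J0. {- int n..int n} \<subseteq> dyadic_ball J"
proof (intro exI[of _ n] allI impI)
  fix J assume "n \<le> J"
  then have "int n < 2 ^ J"
    by (metis of_nat_less_two_power order.strict_trans2 power_increasing one_le_numeral)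
  then have "\<bar>k\<bar> < 2 ^ J" if "k \<in> {- int n..int n}" for k
    using that unfolding atLeastAtMost_iff abs_less_iff by linarith
  then show "{- int n..int n} \<subseteq> dyadic_ball J" by (auto simp: dyadic_ball_def)
qed

section \<open>Bernstein-type estimates for single blocks and their sums\<close>

definition block_norm :: "(int \<Rightarrow> complex) \<Rightarrow> nat \<Rightarrow> real" where
  "block_norm c j = sqrt (\<Sum>k\<in>dyadic_block j. (cmod (c k))\<^sup>2)"

lemma block_norm_nonneg [simp]: "0 \<le> block_norm c j"
  by (simp add: block_norm_def sum_nonneg)

lemma block_norm_sq: "(block_norm c j)\<^sup>2 = (\<Sum>k\<in>dyadic_block j. (cmod (c k))\<^sup>2)"
  by (simp add: block_norm_def sum_nonneg)

text \<open>Bernstein's inequality: Cauchy-Schwarz over the at most 2^(j+1) modes of the block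
  bounds the supremum by \<open>A\<close>, and p - 2 of the p powers are estimated by it. The
  remaining two give the L^2 norm, known from Parseval.\<close>

lemma integral_block_powr:
  assumes L: "L > 0" and p: "p > 2"
  shows "(\<integral>x. cmod (fourier_sum L (dyadic_block j) c x) powr p \<partial>circle_measure L) \<le>
    (2 / L) powr ((p - 2) / 2) * 2 powr (real j * ((p - 2) / 2)) * block_norm c j powr p"
proof -
  define S where "S = fourier_sum L (dyadic_block j) c"
  have S: "continuous_on UNIV S" unfolding S_def by (intro continuous_intros)
  define A where "A = (2 / L * 2 powr real j) powr (1 / 2) * block_norm c j"
  have sup: "cmod (S x) \<le> A" for x
  proof -
    have "cmod (S x) \<le> (\<Sum>k\<in>dyadic_block j. cmod (c k) * L powr (- 1 / 2))"
      unfolding S_def fourier_sum_def by (rule sum_norm_le) (simp add: norm_mult norm_fourier_mode)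
    also have "\<dots> = (\<Sum>k\<in>dyadic_block j. cmod (c k)) * L powr (- 1 / 2)" by (simp add: sum_distrib_right)
    finally have 1: "cmod (S x) \<le> (\<Sum>k\<in>dyadic_block j. cmod (c k)) * L powr (- 1 / 2)" .
    have "(\<Sum>k\<in>dyadic_block j. cmod (c k))\<^sup>2 \<le> (block_norm c j)\<^sup>2 * card (dyadic_block j)"
      unfolding block_norm_sq by (rule sum_squared_le_sum_of_squares)
    also have "\<dots> \<le> (block_norm c j)\<^sup>2 * 2 ^ (j + 1)"
      using of_nat_mono[OF card_dyadic_block[of j], where 'a = real] by (intro mult_left_mono) simp_all
    finally have "(\<Sum>k\<in>dyadic_block j. cmod (c k)) \<le> sqrt ((block_norm c j)\<^sup>2 * 2 ^ (j + 1))"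
      by (rule real_le_rsqrt)
    then have "(\<Sum>k\<in>dyadic_block j. cmod (c k)) \<le> block_norm c j * sqrt (2 ^ (j + 1))"
      by (simp add: real_sqrt_mult)
    then have "(\<Sum>k\<in>dyadic_block j. cmod (c k)) * L powr (- 1 / 2) \<le> block_norm c j * sqrt (2 ^ (j + 1)) * L powr (- 1 / 2)"
      by (intro mult_right_mono) auto
    also have "\<dots> = A"
      using L by (simp add: A_def powr_half_sqrt[symmetric] powr_mult powr_divide powr_minus divide_simps powr_realpow)
    finally show ?thesis using 1 by linarith
  qed
  have A: "A \<ge> 0" unfolding A_def by simp
  have "cmod (S x) powr p \<le> A powr (p - 2) * (cmod (S x))\<^sup>2" for x
  proof -
    have "cmod (S x) powr p = cmod (S x) powr (p - 2) * (cmod (S x))\<^sup>2"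
      by (cases "S x = 0") (simp_all flip: powr_numeral powr_add)
    also have "\<dots> \<le> A powr (p - 2) * (cmod (S x))\<^sup>2"
      using p sup by (intro mult_right_mono powr_mono2) auto
    finally show ?thesis .
  qed
  then have "(\<integral>x. cmod (S x) powr p \<partial>circle_measure L) \<le> (\<integral>x. A powr (p - 2) * (cmod (S x))\<^sup>2 \<partial>circle_measure L)"
    using p by (intro integral_mono integrable_circle continuous_intros S continuous_on_powr') auto
  also have "\<dots> = A powr (p - 2) * (block_norm c j)\<^sup>2"
    using L by (simp add: S_def parseval_fourier_sum block_norm_sq)
  also have "\<dots> = (2 / L * 2 powr real j) powr ((p - 2) / 2) * (block_norm c j powr (p - 2) * (block_norm c j)\<^sup>2)"
    by (simp add: A_def powr_mult powr_powr)
  also have "block_norm c j powr (p - 2) * (block_norm c j)\<^sup>2 = block_norm c j powr p"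
    by (cases "block_norm c j = 0") (simp_all add: less_le flip: powr_numeral powr_add)
  finally show ?thesis by (simp only: S_def powr_mult powr_powr)
qed

text \<open>Bernstein accounts for the exponent (p - 2) / 2. The excess of e over it, written d p,
  pays for the geometric weights 2^(-d j) with which \<open>powr_sum_weighted\<close> separates the
  blocks.\<close>

lemma Lp_fourier_sum_bound:
  assumes L: "L > 0" and p: "p > 2" and e: "e > (p - 2) / 2"
  shows "\<exists>C\<ge>0. \<forall>c J. (\<integral>x. cmod (fourier_sum L (dyadic_ball J) c x) powr p \<partial>circle_measure L) \<le>
    C * (\<Sum>j<Suc J. 2 powr (real j * e) * block_norm c j powr p)"
proof -
  define d where "d = (e - (p - 2) / 2) / p"
  have d: "d > 0" using e p by (simp add: d_def)
  have dp: "(p - 2) / 2 + d * p = e" using p by (simp add: d_def)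
  define q where "q = 2 powr (- d)"
  have q: "0 < q" "q < 1" using d powr_less_mono[of "- d" 0 2] by (auto simp: q_def)
  define W where "W = 1 / (1 - q)"
  have W: "(\<Sum>j<J. q ^ j) \<le> W" for J
    unfolding W_def using q sum_le_suminf[of "\<lambda>j. q ^ j" "{..<J}"]
    by (simp add: suminf_geometric summable_geometric)
  define C where "C = W powr p * (2 / L) powr ((p - 2) / 2)"
  show ?thesis
  proof (intro exI[of _ C] conjI allI)
    show "0 \<le> C" by (simp add: C_def)
    fix c :: "int \<Rightarrow> complex" and J :: nat
    define D where "D j = fourier_sum L (dyadic_block j) c" for j
    have D [continuous_intros]: "continuous_on UNIV (D j)" for j
      unfolding D_def by (intro continuous_intros)
    have int: "integrable (circle_measure L) (\<lambda>x. (cmod (D j x)) powr p)" for j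
      using p by (intro integrable_circle continuous_on_powr' continuous_intros) auto
    have qp: "(t / q ^ j) powr p = 2 powr (real j * (d * p)) * t powr p" if "t \<ge> 0" for t j
    proof -
      have "q ^ j = 2 powr (- (d * j))" by (simp add: q_def powr_powr flip: powr_realpow)
      then have "(q ^ j) powr p = 2 powr (- (real j * (d * p)))" by (simp add: powr_powr mult_ac)
      then show ?thesis unfolding powr_divide powr_minus by (simp add: divide_inverse)
    qed
    have "cmod (fourier_sum L (dyadic_ball J) c x) powr p \<le>
        W powr p * (\<Sum>j<Suc J. 2 powr (real j * (d * p)) * cmod (D j x) powr p)" for x
    proof -
      have "cmod (fourier_sum L (dyadic_ball J) c x) \<le> (\<Sum>j<Suc J. cmod (D j x))"
        unfolding fourier_sum_dyadic_ball D_def by (rule norm_sum)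
      then have "cmod (fourier_sum L (dyadic_ball J) c x) powr p \<le> (\<Sum>j<Suc J. cmod (D j x)) powr p"
        using p by (intro powr_mono2) auto
      also have "\<dots> \<le> W powr p * (\<Sum>j<Suc J. (cmod (D j x) / q ^ j) powr p)"
        using p q W by (intro powr_sum_weighted) (auto simp del: sum.lessThan_Suc)
      finally show ?thesis by (simp add: qp)
    qed
    then have "(\<integral>x. cmod (fourier_sum L (dyadic_ball J) c x) powr p \<partial>circle_measure L) \<le>
        (\<integral>x. W powr p * (\<Sum>j<Suc J. 2 powr (real j * (d * p)) * cmod (D j x) powr p) \<partial>circle_measure L)"
      using p by (intro integral_mono integrable_circle continuous_on_powr' continuous_intros) auto
    also have "\<dots> = W powr p * (\<Sum>j<Suc J. 2 powr (real j * (d * p)) * (\<integral>x. cmod (D j x) powr p \<partial>circle_measure L))"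
      using int by (simp add: Bochner_Integration.integral_sum del: sum.lessThan_Suc)
    also have "\<dots> \<le> W powr p * (\<Sum>j<Suc J. 2 powr (real j * (d * p)) *
        ((2 / L) powr ((p - 2) / 2) * 2 powr (real j * ((p - 2) / 2)) * block_norm c j powr p))"
      unfolding D_def by (intro mult_left_mono sum_mono integral_block_powr L p) auto
    also have "\<dots> = C * (\<Sum>j<Suc J. 2 powr (real j * e) * block_norm c j powr p)"
    proof -
      have "2 powr (real j * (d * p)) * (a * 2 powr (real j * ((p - 2) / 2)) * b) = a * (2 powr (real j * e) * b)"
        for a b :: real and j
      proof -
        have "2 powr (real j * (d * p)) * 2 powr (real j * ((p - 2) / 2)) = 2 powr (real j * e)"
          by (simp add: dp[symmetric] algebra_simps flip: powr_add)
        then show ?thesis by (metis mult.assoc mult.commute)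
      qed
      then show ?thesis unfolding C_def by (simp only: sum_distrib_left[symmetric] mult.assoc[of "W powr p"])
    qed
    finally show "(\<integral>x. cmod (fourier_sum L (dyadic_ball J) c x) powr p \<partial>circle_measure L) \<le>
      C * (\<Sum>j<Suc J. 2 powr (real j * e) * block_norm c j powr p)" .
  qed
qed

section \<open>From partial sums back to the function\<close>

lemma Lq_norm_two_sq: "(Lq_norm L 2 f)\<^sup>2 = (\<integral>x. (cmod (f x))\<^sup>2 \<partial>circle_measure L)"
  and Lq_norm_nonneg [simp]: "0 \<le> Lq_norm L q f"
proof -
  have "0 \<le> (\<integral>x. (cmod (f x))\<^sup>2 \<partial>circle_measure L)" by (rule integral_nonneg_AE) simp
  then show "(Lq_norm L 2 f)\<^sup>2 = (\<integral>x. (cmod (f x))\<^sup>2 \<partial>circle_measure L)"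
    by (simp add: Lq_norm_def circle_integral_eq powr_half_sqrt)
qed (simp add: Lq_norm_def)

lemma Lq_norm_powr:
  assumes "q > 0"
  shows "Lq_norm L q f powr q = (\<integral>x. cmod (f x) powr q \<partial>circle_measure L)"
proof -
  have "0 \<le> (\<integral>x. cmod (f x) powr q \<partial>circle_measure L)" by (rule integral_nonneg_AE) simp
  then show ?thesis using assms by (simp add: Lq_norm_def circle_integral_eq powr_powr)
qed

lemma block_norm_le_Lq_norm:
  assumes "L > 0" "continuous_on UNIV \<phi>"
  shows "block_norm (\<lambda>k. fourier_coeff L k \<phi>) j \<le> Lq_norm L 2 \<phi>"
proof (rule power2_le_imp_le)
  show "(block_norm (\<lambda>k. fourier_coeff L k \<phi>) j)\<^sup>2 \<le> (Lq_norm L 2 \<phi>)\<^sup>2"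
    unfolding Lq_norm_two_sq block_norm_sq by (rule bessel_inequality) (use assms in auto)
qed simp

text \<open>Mean-square convergence gives convergence in L^1, hence almost everywhere along a
  subsequence, and Fatou's lemma transfers the bound. Pointwise convergence of the full series is
  not assumed.\<close>

lemma integral_powr_le_of_fourier_sums:
  assumes L: "L > 0" and cont: "continuous_on UNIV \<phi>" and per: "\<And>x. \<phi> (x + L) = \<phi> x"
    and p: "p > 0" and B: "\<And>J. (\<integral>x. cmod (fourier_sum L (dyadic_ball J) (\<lambda>k. fourier_coeff L k \<phi>) x) powr p
        \<partial>circle_measure L) \<le> B"
  shows "(\<integral>x. cmod (\<phi> x) powr p \<partial>circle_measure L) \<le> B"
proof -
  define S where "S J = fourier_sum L (dyadic_ball J) (\<lambda>k. fourier_coeff L k \<phi>)" for J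
  have S [continuous_intros]: "continuous_on UNIV (S J)" for J
    unfolding S_def by (intro continuous_intros)
  note [continuous_intros] = cont
  have [measurable]: "S J \<in> borel_measurable borel" "\<phi> \<in> borel_measurable borel" for J
    using S cont by (auto intro: borel_measurable_continuous_onI)
  define d where "d J = (\<integral>x. (cmod (S J x - \<phi> x))\<^sup>2 \<partial>circle_measure L)" for J
  have d0: "d J \<ge> 0" for J unfolding d_def by (rule integral_nonneg_AE) simp
  have d: "d \<longlonglongrightarrow> 0"
  proof (rule LIMSEQ_I)
    fix e :: real assume e: "0 < e"
    obtain n :: nat where n: "\<And>K. finite K \<Longrightarrow> {- int n..int n} \<subseteq> K \<Longrightarrow>
      (\<integral>x. (cmod (\<phi> x - fourier_sum L K (\<lambda>k. fourier_coeff L k \<phi>) x))\<^sup>2 \<partial>circle_measure L) \<le> e / 2"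
      using fourier_sum_L2_approx[OF L cont per, of "e / 2"] e by auto
    obtain J0 where "\<And>J. J \<ge> J0 \<Longrightarrow> {- int n..int n} \<subseteq> dyadic_ball J"
      using subset_dyadic_ball by blast
    with n have "d J \<le> e / 2" if "J \<ge> J0" for J
      using that unfolding d_def S_def by (simp add: norm_minus_commute)
    then show "\<exists>J0. \<forall>J\<ge>J0. norm (d J - 0) < e"
      using e d0 by (intro exI[of _ J0]) (force intro: order.strict_trans1)
  qed
  have le: "(\<integral>x. cmod (S J x - \<phi> x) \<partial>circle_measure L) \<le> sqrt (L * d J)" for J
  proof (rule real_le_rsqrt)
    have "integrable (circle_measure L) (\<lambda>x. (cmod (S J x - \<phi> x))\<^sup>2)"
      by (intro integrable_circle continuous_intros)
    moreover have "(\<lambda>x. S J x - \<phi> x) \<in> borel_measurable (circle_measure L)" by measurable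
    ultimately show "(\<integral>x. cmod (S J x - \<phi> x) \<partial>circle_measure L)\<^sup>2 \<le> L * d J"
      unfolding d_def using integral_abs_squared_le(2)[OF L] by blast
  qed
  have "(\<lambda>J. sqrt (L * d J)) \<longlonglongrightarrow> sqrt (L * 0)" by (intro tendsto_intros d)
  then have lim: "(\<lambda>J. sqrt (L * d J)) \<longlonglongrightarrow> 0" by simp
  have "(\<lambda>J. \<integral>x. cmod (S J x - \<phi> x) \<partial>circle_measure L) \<longlonglongrightarrow> 0"
    by (rule tendsto_sandwich[OF _ _ tendsto_const lim]) (auto simp: le integral_nonneg_AE)
  then obtain r where r: "strict_mono r" "AE x in circle_measure L. (\<lambda>n. S (r n) x - \<phi> x) \<longlonglongrightarrow> 0"
    using tendsto_L1_AE_subseq[of "circle_measure L" "\<lambda>J x. S J x - \<phi> x"]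
    by (auto intro!: integrable_circle continuous_intros)
  have "AE x in circle_measure L. ennreal (cmod (\<phi> x) powr p) \<le> liminf (\<lambda>n. ennreal (cmod (S (r n) x) powr p))"
    using r(2)
  proof eventually_elim
    case (elim x)
    then have "(\<lambda>n. S (r n) x) \<longlonglongrightarrow> \<phi> x" by (simp add: LIM_zero_iff)
    then have "(\<lambda>n. ennreal (cmod (S (r n) x) powr p)) \<longlonglongrightarrow> ennreal (cmod (\<phi> x) powr p)"
      using p by (intro tendsto_ennrealI tendsto_powr2 tendsto_norm) auto
    from lim_imp_Liminf[OF _ this] show ?case by simp
  qed
  then have "(\<integral>\<^sup>+x. ennreal (cmod (\<phi> x) powr p) \<partial>circle_measure L) \<le>
      (\<integral>\<^sup>+x. liminf (\<lambda>n. ennreal (cmod (S (r n) x) powr p)) \<partial>circle_measure L)"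
    by (rule nn_integral_mono_AE)
  also have "\<dots> \<le> liminf (\<lambda>n. \<integral>\<^sup>+x. ennreal (cmod (S (r n) x) powr p) \<partial>circle_measure L)"
    by (intro nn_integral_liminf) measurable
  also have "\<dots> \<le> liminf (\<lambda>n. ennreal B)"
  proof (intro Liminf_mono always_eventually allI)
    fix n
    have "(\<integral>\<^sup>+x. ennreal (cmod (S (r n) x) powr p) \<partial>circle_measure L) =
        ennreal (\<integral>x. cmod (S (r n) x) powr p \<partial>circle_measure L)"
      using p by (intro nn_integral_eq_integral integrable_circle continuous_on_powr' continuous_intros) auto
    also have "\<dots> \<le> ennreal B" using B[of "r n"] unfolding S_def by (rule ennreal_leI)
    finally show "(\<integral>\<^sup>+x. ennreal (cmod (S (r n) x) powr p) \<partial>circle_measure L) \<le> ennreal B" .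
  qed
  also have "\<dots> = ennreal B" by (simp add: Liminf_const)
  also have "(\<integral>\<^sup>+x. ennreal (cmod (\<phi> x) powr p) \<partial>circle_measure L) =
      ennreal (\<integral>x. cmod (\<phi> x) powr p \<partial>circle_measure L)"
    using p by (intro nn_integral_eq_integral integrable_circle continuous_on_powr' continuous_intros) auto
  \<comment> \<open>The case J = 0 shows that \<open>B\<close> is nonnegative, so the comparison in
    \<open>ennreal\<close> descends to the reals.\<close>
  finally show ?thesis
    using order_trans[OF _ B[of 0], of 0] by (subst (asm) ennreal_le_iff) (auto intro: integral_nonneg_AE)
qed

text \<open>(p - 2) / (2 p) = 1/2 - 1/p is the Gagliardo-Nirenberg exponent in dimension one: the
  fraction of H^1 regularity that controls L^p. The strict inequality is the room for the weights in
  \<open>Lp_fourier_sum_bound\<close>.\<close>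

lemma Lp_norm_bound:
  assumes L: "L > 0" and p: "p > 2" and s: "(p - 2) / (2 * p) < s" "s < 1" and K: "K \<ge> 0"
  shows "\<exists>C\<ge>0. \<forall>\<phi> G. continuous_on UNIV \<phi> \<longrightarrow> (\<forall>x. \<phi> (x + L) = \<phi> x) \<longrightarrow> 0 \<le> G \<longrightarrow>
      (\<forall>j. (block_norm (\<lambda>k. fourier_coeff L k \<phi>) j)\<^sup>2 \<le> K * (1 / 2 ^ j + G / 4 ^ j)) \<longrightarrow>
      (\<integral>x. cmod (\<phi> x) powr p \<partial>circle_measure L) \<le>
        C * (1 + Lq_norm L 2 \<phi> powr (p * (1 - s)) * G powr (p * s / 2))"
proof -
  have s': "(p - 2) / 2 < p * s" using s p by (simp add: field_simps)
  \<comment> \<open>\<open>t\<close> is the smaller ceiling that \<open>dyadic_sum_bound\<close>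
    puts on e; it exceeds the Bernstein exponent, so e fits between.\<close>
  define t where "t = min (p / 2) (p * s)"
  have t: "(p - 2) / 2 < t" "t \<le> p / 2" "t \<le> p * s" using s' by (auto simp: t_def)
  obtain e where e: "(p - 2) / 2 < e" "e < t" using dense[OF t(1)] by blast
  then have e': "e < p / 2" "e < p * s" using t by auto
  have s0: "0 < s" using s p by (auto intro: le_less_trans[OF _ s(1)])
  obtain C1 where C1: "C1 \<ge> 0" "\<And>c J. (\<integral>x. cmod (fourier_sum L (dyadic_ball J) c x) powr p \<partial>circle_measure L) \<le>
    C1 * (\<Sum>j<Suc J. 2 powr (real j * e) * block_norm c j powr p)"
    using Lp_fourier_sum_bound[OF L p e(1)] by blast
  obtain C2 where C2: "C2 \<ge> 0" "\<And>b N G J. 0 \<le> G \<Longrightarrow>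
      (\<And>j::nat. 0 \<le> b j \<and> b j \<le> N \<and> (b j)\<^sup>2 \<le> K * (1 / 2 ^ j + G / 4 ^ j)) \<Longrightarrow>
      (\<Sum>j<J. 2 powr (real j * e) * b j powr p) \<le> C2 * (1 + N powr (p * (1 - s)) * G powr (p * s / 2))"
    using dyadic_sum_bound[OF s0 s(2), of p e K] p e' K by auto
  show ?thesis
  proof (intro exI[of _ "C1 * C2"] conjI allI impI)
    show "0 \<le> C1 * C2" using C1 C2 by simp
    fix \<phi> :: "real \<Rightarrow> complex" and G :: real
    assume \<phi>: "continuous_on UNIV \<phi>" "\<forall>x. \<phi> (x + L) = \<phi> x" and G: "0 \<le> G"
      and b: "\<forall>j. (block_norm (\<lambda>k. fourier_coeff L k \<phi>) j)\<^sup>2 \<le> K * (1 / 2 ^ j + G / 4 ^ j)"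
    show "(\<integral>x. cmod (\<phi> x) powr p \<partial>circle_measure L) \<le>
        C1 * C2 * (1 + Lq_norm L 2 \<phi> powr (p * (1 - s)) * G powr (p * s / 2))"
    proof (rule integral_powr_le_of_fourier_sums[OF L \<phi>(1)])
      fix J
      have "(\<integral>x. cmod (fourier_sum L (dyadic_ball J) (\<lambda>k. fourier_coeff L k \<phi>) x) powr p \<partial>circle_measure L) \<le>
        C1 * (\<Sum>j<Suc J. 2 powr (real j * e) * block_norm (\<lambda>k. fourier_coeff L k \<phi>) j powr p)"
        by (rule C1(2))
      also have "\<dots> \<le> C1 * (C2 * (1 + Lq_norm L 2 \<phi> powr (p * (1 - s)) * G powr (p * s / 2)))"
        using b by (intro mult_left_mono C2(2) C1(1) G) (simp add: block_norm_le_Lq_norm L \<phi>)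
      finally show "(\<integral>x. cmod (fourier_sum L (dyadic_ball J) (\<lambda>k. fourier_coeff L k \<phi>) x) powr p \<partial>circle_measure L) \<le>
        C1 * C2 * (1 + Lq_norm L 2 \<phi> powr (p * (1 - s)) * G powr (p * s / 2))" by (simp add: mult.assoc)
    qed (use \<phi> p in auto)
  qed
qed

section \<open>Exponential moments of the Gaussian measure\<close>

lemma eigval_pos: "m > 0 \<Longrightarrow> eigval L m k > 0"
  by (simp add: eigval_def add_nonneg_pos)

text \<open>For j > 0 the smallest frequency 2^(j-1) contributes (2 pi / L)^2 4^(j-1) = (pi / L)^2
  4^j, while block 0 has only m^2; hence the minimum in the lower constant.\<close>

lemma eigval_dyadic_bounds:
  assumes L: "L > 0" and m: "m > 0" and k: "k \<in> dyadic_block j"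
  shows "min (m\<^sup>2) ((pi / L)\<^sup>2) * 4 ^ j \<le> eigval L m k"
    and "eigval L m k \<le> ((2 * pi / L)\<^sup>2 + m\<^sup>2) * 4 ^ j"
proof -
  have eq: "eigval L m k = (2 * pi / L)\<^sup>2 * \<bar>of_int k\<bar>\<^sup>2 + m\<^sup>2"
    by (simp add: eigval_def power_mult_distrib power_divide)
  have pow4: "(2 ^ i)\<^sup>2 = (4 ^ i :: real)" for i
    by (simp add: power2_eq_square flip: power_mult_distrib)
  show "min (m\<^sup>2) ((pi / L)\<^sup>2) * 4 ^ j \<le> eigval L m k"
  proof (cases j)
    case 0
    then show ?thesis by (simp add: eq min.coboundedI1 add_increasing)
  next
    case (Suc i)
    with k have "2 ^ i \<le> \<bar>k\<bar>" by simp
    then have "2 ^ i \<le> \<bar>real_of_int k\<bar>" by (metis of_int_abs of_int_le_iff of_int_numeral of_int_power)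
    then have "(2 ^ i)\<^sup>2 \<le> \<bar>real_of_int k\<bar>\<^sup>2" by (intro power_mono) auto
    then have "(2 * pi / L)\<^sup>2 * (2 ^ i)\<^sup>2 \<le> eigval L m k"
      unfolding eq by (intro add_increasing2 mult_left_mono) auto
    moreover have "(2 * pi / L)\<^sup>2 * (2 ^ i)\<^sup>2 = (pi / L)\<^sup>2 * 4 ^ j"
      by (simp add: Suc pow4 power_mult_distrib power_divide)
    moreover have "min (m\<^sup>2) ((pi / L)\<^sup>2) * 4 ^ j \<le> (pi / L)\<^sup>2 * 4 ^ j"
      by (intro mult_right_mono) auto
    ultimately show ?thesis by linarith
  qed
  have "\<bar>k\<bar> < 2 ^ j" using dyadic_block_subset[of j] k by (auto simp: dyadic_ball_def)
  then have "\<bar>k\<bar> \<le> 2 ^ j" by simp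
  then have "\<bar>real_of_int k\<bar> \<le> 2 ^ j" by (metis of_int_abs of_int_le_iff of_int_numeral of_int_power)
  then have "\<bar>real_of_int k\<bar>\<^sup>2 \<le> (2 ^ j)\<^sup>2" by (intro power_mono) auto
  also have "(2 ^ j)\<^sup>2 = (4 ^ j :: real)" by (rule pow4)
  finally have "(2 * pi / L)\<^sup>2 * \<bar>of_int k\<bar>\<^sup>2 \<le> (2 * pi / L)\<^sup>2 * 4 ^ j" by (intro mult_left_mono) auto
  moreover have "m\<^sup>2 * 1 \<le> m\<^sup>2 * 4 ^ j" by (intro mult_left_mono) auto
  ultimately show "eigval L m k \<le> ((2 * pi / L)\<^sup>2 + m\<^sup>2) * 4 ^ j"
    unfolding eq by (simp add: algebra_simps)
qed

text \<open>Dilating by \<open>\<surd>2\<close> turns the integrand into twice the density, whose integral is known.\<close>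

lemma gaussian_exp_moment:
  fixes X :: "'a \<Rightarrow> complex"
  assumes "prob_space M" and X: "distributed M lborel X (\<lambda>z. ennreal (\<theta> / (2 * pi) * exp (- \<theta> * (cmod z)\<^sup>2 / 2)))"
    and \<theta>: "\<theta> > 0"
  shows "(\<integral>\<^sup>+x. ennreal (exp (\<theta> * (cmod (X x))\<^sup>2 / 4)) \<partial>M) = 2"
proof -
  interpret prob_space M by fact
  define f where "f = (\<lambda>z::complex. ennreal (\<theta> / (2 * pi) * exp (- \<theta> * (cmod z)\<^sup>2 / 2)))"
  define h where "h = (\<lambda>z::complex. ennreal (\<theta> / (2 * pi) * exp (- \<theta> * (cmod z)\<^sup>2 / 4)))"
  have [measurable]: "f \<in> borel_measurable borel" "h \<in> borel_measurable borel"
    unfolding f_def h_def by measurable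
  have "(\<integral>\<^sup>+z. f z * 1 \<partial>lborel) = (\<integral>\<^sup>+x. 1 \<partial>M)"
    unfolding f_def by (rule distributed_nn_integral[OF X]) simp
  then have f1: "(\<integral>\<^sup>+z. f z \<partial>lborel) = 1" by (simp add: emeasure_space_1)
  have "(\<integral>\<^sup>+x. ennreal (exp (\<theta> * (cmod (X x))\<^sup>2 / 4)) \<partial>M) =
      (\<integral>\<^sup>+z. f z * ennreal (exp (\<theta> * (cmod z)\<^sup>2 / 4)) \<partial>lborel)"
    unfolding f_def by (rule distributed_nn_integral[OF X, symmetric]) measurable
  also have "\<dots> = (\<integral>\<^sup>+z. h z \<partial>lborel)"
  proof (rule nn_integral_cong)
    fix z :: complex
    have "exp (- \<theta> * (cmod z)\<^sup>2 / 2) * exp (\<theta> * (cmod z)\<^sup>2 / 4) = exp (- \<theta> * (cmod z)\<^sup>2 / 4)"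
      by (simp flip: exp_add)
    then show "f z * ennreal (exp (\<theta> * (cmod z)\<^sup>2 / 4)) = h z"
      using \<theta> by (simp add: f_def h_def mult.assoc flip: ennreal_mult)
  qed
  also have "\<dots> = (\<integral>\<^sup>+z. h z \<partial>density (distr lborel borel (\<lambda>x::complex. 0 + sqrt 2 *\<^sub>R x)) (\<lambda>_. ennreal (\<bar>sqrt 2\<bar> ^ DIM(complex))))"
    by (subst lborel_affine[of "sqrt 2" "0::complex"]) auto
  \<comment> \<open>The Jacobian of the dilation is 2 because the plane has real dimension
    two.\<close>
  also have "\<dots> = 2 * (\<integral>\<^sup>+x. h (sqrt 2 *\<^sub>R x) \<partial>lborel)"
    by (simp add: nn_integral_density nn_integral_distr nn_integral_cmult)
  also have "(\<integral>\<^sup>+x. h (sqrt 2 *\<^sub>R x) \<partial>lborel) = (\<integral>\<^sup>+x. f x \<partial>lborel)"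
    by (intro nn_integral_cong) (simp add: f_def h_def power_mult_distrib norm_mult)
  finally show ?thesis using f1 by simp
qed

text \<open>Each coefficient is weighted by half of the rate at which its exponential moment would
  diverge. In this normalisation every mode contributes the same factor 2, and independence
  multiplies them.\<close>

lemma gaussian_exp_moment_sum:
  assumes L: "L > 0" and m: "m > 0" and \<beta>: "\<beta> > 0" and M: "is_gaussian_measure L m \<beta> M" and K: "finite K"
  shows "(\<integral>\<^sup>+\<phi>. ennreal (exp (\<Sum>k\<in>K. \<beta> * eigval L m k * (cmod (fourier_coeff L k (apply_bcontfun \<phi>)))\<^sup>2 / 4)) \<partial>M) = 2 ^ card K"
proof -
  define X where "X k \<phi> = fourier_coeff L k (apply_bcontfun \<phi>)" for k \<phi>
  interpret prob_space M using M by (simp add: is_gaussian_measure_def)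
  have indep: "indep_vars (\<lambda>_. borel) X UNIV"
    using M by (simp add: is_gaussian_measure_def X_def[abs_def])
  have X: "distributed M lborel (X k) (\<lambda>z. ennreal (\<beta> * eigval L m k / (2 * pi) * exp (- (\<beta> * eigval L m k) * (cmod z)\<^sup>2 / 2)))" for k
    using M by (simp add: is_gaussian_measure_def X_def[abs_def] Let_def)
  have "indep_vars (\<lambda>_. borel) (\<lambda>k \<phi>. ennreal (exp (\<beta> * eigval L m k * (cmod (X k \<phi>))\<^sup>2 / 4))) K"
    by (rule indep_vars_compose2[OF indep_vars_subset[OF indep]]) (auto intro!: measurable_compose[OF _ measurable_ennreal])
  then have "(\<integral>\<^sup>+\<phi>. (\<Prod>k\<in>K. ennreal (exp (\<beta> * eigval L m k * (cmod (X k \<phi>))\<^sup>2 / 4))) \<partial>M) =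
      (\<Prod>k\<in>K. \<integral>\<^sup>+\<phi>. ennreal (exp (\<beta> * eigval L m k * (cmod (X k \<phi>))\<^sup>2 / 4)) \<partial>M)"
    by (intro indep_vars_nn_integral K) auto
  also have "\<dots> = (\<Prod>k\<in>K. 2)"
    using m \<beta> by (intro prod.cong refl gaussian_exp_moment[OF prob_space_axioms X]) (simp add: eigval_pos)
  finally show ?thesis using K by (simp add: X_def exp_sum prod_ennreal)
qed

text \<open>\<open>H\<close> collects the normalised exponentials of all block energies in one
  series. A single term never exceeds the sum, so taking logarithms bounds every block at once, at
  the price of the deterministic shift in \<open>Y\<close>.\<close>

lemma gaussian_block_bounds:
  assumes L: "L > 0" and m: "m > 0" and \<beta>: "\<beta> > 0" and M: "is_gaussian_measure L m \<beta> M"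
  obtains K H where "K \<ge> 0" "integrable M H"
    "AE \<phi> in M. 1 \<le> H \<phi> \<and> (\<forall>j. (block_norm (\<lambda>k. fourier_coeff L k (apply_bcontfun \<phi>)) j)\<^sup>2
        \<le> K * (1 / 2 ^ j + ln (H \<phi>) / 4 ^ j))"
proof -
  interpret prob_space M using M by (simp add: is_gaussian_measure_def)
  define X where "X k \<phi> = fourier_coeff L k (apply_bcontfun \<phi>)" for k \<phi>
  have "indep_vars (\<lambda>_. borel) X UNIV"
    using M by (simp add: is_gaussian_measure_def X_def[abs_def])
  then have [measurable]: "X k \<in> borel_measurable M" for k by (simp add: indep_vars_def)
  define E where "E j \<phi> = (\<Sum>k\<in>dyadic_block j. \<beta> * eigval L m k * (cmod (X k \<phi>))\<^sup>2 / 4)" for j \<phi>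
  \<comment> \<open>The shift beats the mean: at most 2^(j+1) modes give a moment of at most
    2^(2^(j+1)), and exp (-4 * 2^j) = exp (-2)^(2^(j+1)) with exp 2 \<ge> 4 leaves at most
    (1/2)^(2^(j+1)), which is summable in j.\<close>
  define Y where "Y j \<phi> = exp (E j \<phi> - 4 * 2 ^ j)" for j \<phi>
  have [measurable]: "E j \<in> borel_measurable M" "Y j \<in> borel_measurable M" for j
    unfolding E_def[abs_def] Y_def[abs_def] by measurable
  have Ybound: "(\<integral>\<^sup>+\<phi>. ennreal (Y j \<phi>) \<partial>M) \<le> ennreal ((1 / 2) ^ j)" for j
  proof -
    have EE: "(\<integral>\<^sup>+\<phi>. ennreal (exp (E j \<phi>)) \<partial>M) = 2 ^ card (dyadic_block j)"
      unfolding E_def X_def by (rule gaussian_exp_moment_sum[OF L m \<beta> M]) simp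
    have "(\<integral>\<^sup>+\<phi>. ennreal (Y j \<phi>) \<partial>M) = (\<integral>\<^sup>+\<phi>. ennreal (exp (E j \<phi>)) * ennreal (exp (- (4 * 2 ^ j))) \<partial>M)"
      by (simp add: Y_def exp_diff exp_minus divide_inverse ennreal_mult)
    also have "\<dots> = 2 ^ card (dyadic_block j) * ennreal (exp (- (4 * 2 ^ j)))"
      by (subst nn_integral_multc) (simp_all add: EE)
    also have "\<dots> \<le> 2 ^ (2 ^ (j + 1)) * ennreal (exp (- (4 * 2 ^ j)))"
      by (intro mult_right_mono power_increasing card_dyadic_block) auto
    also have "\<dots> = ennreal (2 ^ (2 ^ (j + 1)) * exp (- (4 * 2 ^ j)))"
      by (simp add: ennreal_mult flip: ennreal_power)
    also have "\<dots> \<le> ennreal ((1 / 2) ^ j)"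
    proof (rule ennreal_leI)
      have e: "exp (- 2) \<le> (1 / 4 :: real)"
      proof -
        have "(2::real) \<le> exp 1" using exp_ge_add_one_self[of "1::real"] by simp
        then have "2 * 2 \<le> exp 1 * exp (1::real)" by (intro mult_mono) auto
        then show ?thesis by (simp add: exp_minus field_simps flip: exp_add)
      qed
      have "exp (- (4 * 2 ^ j)) = exp (- 2 :: real) ^ (2 ^ (j + 1))"
        by (simp flip: exp_of_nat_mult)
      then have "2 ^ (2 ^ (j + 1)) * exp (- (4 * 2 ^ j)) = (2 * exp (- 2 :: real)) ^ (2 ^ (j + 1))"
        by (simp add: power_mult_distrib)
      also have "\<dots> \<le> (1 / 2) ^ (2 ^ (j + 1))" using e by (intro power_mono) auto
      also have "\<dots> \<le> (1 / 2) ^ j"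
        by (intro power_decreasing) (auto intro: order_trans[OF less_imp_le[OF less_exp]])
      finally show "2 ^ (2 ^ (j + 1)) * exp (- (4 * 2 ^ j)) \<le> (1 / 2 :: real) ^ j" .
    qed
    finally show ?thesis .
  qed
  have Y0: "0 \<le> Y j \<phi>" for j \<phi> by (simp add: Y_def)
  have int: "integrable M (Y j)" for j
    using Ybound[of j] by (intro integrableI_nonneg) (auto simp: Y0 order.strict_trans1[OF _ ennreal_less_top])
  have "(\<integral>x. Y j x \<partial>M) \<le> (1 / 2) ^ j" for j
    using Ybound[of j] by (subst (asm) nn_integral_eq_integral) (auto simp: int Y0)
  then have "summable (\<lambda>j. \<integral>x. norm (Y j x) \<partial>M)"
    by (intro summable_comparison_test[OF _ summable_geometric[of "1 / 2 :: real"]]) (auto simp: Y0 integral_nonneg_AE)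
  \<comment> \<open>A real \<open>suminf\<close> dominates its terms only if the series converges;
    finiteness of the integrated \<open>ennreal\<close> series gives this almost surely.\<close>
  moreover have sum: "AE x in M. summable (\<lambda>j. Y j x)"
  proof -
    have "(\<integral>\<^sup>+x. (\<Sum>j. ennreal (Y j x)) \<partial>M) = (\<Sum>j. \<integral>\<^sup>+x. ennreal (Y j x) \<partial>M)"
      by (intro nn_integral_suminf) measurable
    also have "\<dots> \<le> (\<Sum>j. ennreal ((1 / 2) ^ j))" by (intro suminf_le Ybound) auto
    also have "\<dots> = ennreal (\<Sum>j. (1 / 2) ^ j)" by (intro suminf_ennreal2) (auto intro: summable_geometric)
    also have "\<dots> < \<infinity>" by simp
    finally have "AE x in M. (\<Sum>j. ennreal (Y j x)) \<noteq> \<infinity>" by (intro nn_integral_PInf_AE) auto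
    then show ?thesis
      by eventually_elim (intro summable_suminf_not_top Y0, simp)
  qed
  ultimately have int_sum: "integrable M (\<lambda>x. \<Sum>j. Y j x)"
    using int by (intro integrable_suminf) (auto simp: Y0)
  \<comment> \<open>The added 1 makes \<open>ln (H x)\<close> nonnegative, as the role of G
    requires.\<close>
  define H where "H x = 1 + (\<Sum>j. Y j x)" for x
  define c where "c = min (m\<^sup>2) ((pi / L)\<^sup>2)"
  have c: "c > 0" using L m by (simp add: c_def)
  have "AE \<phi> in M. 1 \<le> H \<phi> \<and> (\<forall>j. (block_norm (\<lambda>k. fourier_coeff L k (apply_bcontfun \<phi>)) j)\<^sup>2
        \<le> 16 / (\<beta> * c) * (1 / 2 ^ j + ln (H \<phi>) / 4 ^ j))"
    using sum
  proof (eventually_elim, intro conjI allI)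
    fix \<phi> assume sm: "summable (\<lambda>j. Y j \<phi>)"
    have H1: "1 \<le> H \<phi>" unfolding H_def using suminf_nonneg[OF sm] Y0 by simp
    then show "1 \<le> H \<phi>" .
    fix j
    have "Y j \<phi> \<le> (\<Sum>j. Y j \<phi>)" using sum_le_suminf[OF sm, of "{j}"] Y0 by simp
    then have "Y j \<phi> \<le> H \<phi>" by (simp add: H_def)
    then have "ln (Y j \<phi>) \<le> ln (H \<phi>)" using H1 by (subst ln_le_cancel_iff) (auto simp: Y_def)
    then have 1: "E j \<phi> \<le> ln (H \<phi>) + 4 * 2 ^ j" by (simp add: Y_def)
    have "(\<Sum>k\<in>dyadic_block j. \<beta> * c * 4 ^ j / 4 * (cmod (X k \<phi>))\<^sup>2) \<le> E j \<phi>"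
      unfolding E_def
    proof (rule sum_mono)
      fix k assume "k \<in> dyadic_block j"
      then have "c * 4 ^ j \<le> eigval L m k" unfolding c_def by (rule eigval_dyadic_bounds[OF L m])
      then have "\<beta> * (c * 4 ^ j) * ((cmod (X k \<phi>))\<^sup>2 / 4) \<le> \<beta> * eigval L m k * ((cmod (X k \<phi>))\<^sup>2 / 4)"
        using \<beta> by (intro mult_right_mono mult_left_mono) auto
      then show "\<beta> * c * 4 ^ j / 4 * (cmod (X k \<phi>))\<^sup>2 \<le> \<beta> * eigval L m k * (cmod (X k \<phi>))\<^sup>2 / 4"
        by (simp add: mult_ac)
    qed
    then have 2: "\<beta> * c * 4 ^ j / 4 * (block_norm (\<lambda>k. X k \<phi>) j)\<^sup>2 \<le> E j \<phi>"
      by (simp add: block_norm_sq sum_distrib_left)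
    define b where "b = (block_norm (\<lambda>k. X k \<phi>) j)\<^sup>2"
    have ln0: "0 \<le> ln (H \<phi>)" using H1 by simp
    have "\<beta> * c * 4 ^ j / 4 * b \<le> ln (H \<phi>) + 4 * 2 ^ j" using 1 2 by (simp add: b_def)
    \<comment> \<open>The 16 in the final constant is this factor 4 times the divisor 4 in
      \<open>E\<close>.\<close>
    also have "\<dots> \<le> 4 * (ln (H \<phi>) + 2 ^ j)" using ln0 by simp
    finally have "\<beta> * c * 4 ^ j * b \<le> 16 * (ln (H \<phi>) + 2 ^ j)" by simp
    then have "b \<le> 16 * (ln (H \<phi>) + 2 ^ j) / (\<beta> * c * 4 ^ j)"
      using \<beta> c by (simp add: field_simps)
    also have "\<dots> = 16 / (\<beta> * c) * (2 ^ j / 4 ^ j + ln (H \<phi>) / 4 ^ j)"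
      using \<beta> c by (simp add: field_simps)
    also have "2 ^ j / 4 ^ j = (1 / 2 ^ j :: real)"
      by (simp add: field_simps flip: power_mult_distrib)
    finally show "(block_norm (\<lambda>k. fourier_coeff L k (apply_bcontfun \<phi>)) j)\<^sup>2
        \<le> 16 / (\<beta> * c) * (1 / 2 ^ j + ln (H \<phi>) / 4 ^ j)" by (simp add: b_def X_def)
  qed
  moreover have "integrable M H" unfolding H_def using int_sum by simp
  ultimately show ?thesis using \<beta> c by (intro that[of "16 / (\<beta> * c)" H]) auto
qed

section \<open>Measurability and fractional powers of the elliptic operator\<close>

text \<open>The sup metric controls the change of function uniformly in the point. Joint continuity
  is what makes integrals over the period continuous in the function.\<close>

lemma continuous_apply_bcontfun:
  "continuous_on UNIV (\<lambda>(\<phi>, x). apply_bcontfun (\<phi> :: 'a::metric_space \<Rightarrow>\<^sub>C 'b::metric_space) x)"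
proof -
  have "isCont (\<lambda>(\<phi>, x). apply_bcontfun \<phi> x) (\<phi>0, x0)" for \<phi>0 :: "'a \<Rightarrow>\<^sub>C 'b" and x0
    unfolding isCont_def
  proof (subst tendsto_dist_iff, rule tendsto_sandwich[OF always_eventually always_eventually tendsto_const])
    show "\<forall>y. dist (case y of (\<phi>, x) \<Rightarrow> apply_bcontfun \<phi> x) (case (\<phi>0, x0) of (\<phi>, x) \<Rightarrow> apply_bcontfun \<phi> x)
        \<le> dist (fst y) \<phi>0 + dist (apply_bcontfun \<phi>0 (snd y)) (apply_bcontfun \<phi>0 x0)"
    proof
      fix y :: "('a \<Rightarrow>\<^sub>C 'b) \<times> 'a"
      have "dist (apply_bcontfun (fst y) (snd y)) (apply_bcontfun \<phi>0 x0) \<le>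
          dist (apply_bcontfun (fst y) (snd y)) (apply_bcontfun \<phi>0 (snd y)) +
          dist (apply_bcontfun \<phi>0 (snd y)) (apply_bcontfun \<phi>0 x0)" by (rule dist_triangle)
      also have "dist (apply_bcontfun (fst y) (snd y)) (apply_bcontfun \<phi>0 (snd y)) \<le> dist (fst y) \<phi>0"
        by (rule dist_bounded)
      finally show "dist (case y of (\<phi>, x) \<Rightarrow> apply_bcontfun \<phi> x) (case (\<phi>0, x0) of (\<phi>, x) \<Rightarrow> apply_bcontfun \<phi> x)
        \<le> dist (fst y) \<phi>0 + dist (apply_bcontfun \<phi>0 (snd y)) (apply_bcontfun \<phi>0 x0)"
        by (simp add: split_beta)
    qed
    have "isCont (apply_bcontfun \<phi>0) x0" 
      by (metis continuous_on_apply_bcontfun continuous_on_eq_continuous_at open_UNIV UNIV_I)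
    then have "isCont (\<lambda>y. dist (fst y) \<phi>0 + dist (apply_bcontfun \<phi>0 (snd y)) (apply_bcontfun \<phi>0 x0)) (\<phi>0, x0)"
      by (intro continuous_intros isCont_o2[of "(\<phi>0, x0)" snd "apply_bcontfun \<phi>0"]) simp_all
    then show "((\<lambda>y. dist (fst y) \<phi>0 + dist (apply_bcontfun \<phi>0 (snd y)) (apply_bcontfun \<phi>0 x0)) \<longlongrightarrow> 0) (at (\<phi>0, x0))"
      by (simp add: isCont_def)
  qed simp
  then show ?thesis by (simp add: continuous_on_eq_continuous_at)
qed

lemma continuous_bcontfun_UNIV: "continuous_on UNIV (apply_bcontfun \<phi>)"
  by (rule continuous_on_apply_bcontfun)

text \<open>The common source of measurability: Fourier coefficients, Lebesgue norms and cubic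
  pairings with a mode are all built from such integrals, and continuity in the sup metric makes
  them Borel.\<close>

lemma continuous_circle_integral:
  fixes F :: "complex \<Rightarrow> real \<Rightarrow> 'a::euclidean_space"
  assumes F: "continuous_on UNIV (\<lambda>(z, x). F z x)"
  shows "continuous_on UNIV (\<lambda>\<phi>::real \<Rightarrow>\<^sub>C complex. \<integral>x. F (apply_bcontfun \<phi> x) x \<partial>circle_measure L)"
proof -
  have "continuous_on UNIV (\<lambda>y::(real \<Rightarrow>\<^sub>C complex) \<times> real. (case y of (\<phi>, x) \<Rightarrow> apply_bcontfun \<phi> x, snd y))"
    by (intro continuous_intros continuous_apply_bcontfun)
  from continuous_on_compose2[OF F this]
  have cont: "continuous_on UNIV (\<lambda>(\<phi>::real \<Rightarrow>\<^sub>C complex, x). F (apply_bcontfun \<phi> x) x)"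
    by (simp add: split_beta)
  have "(\<integral>x. F (apply_bcontfun \<phi> x) x \<partial>circle_measure L) = integral (cbox 0 L) (\<lambda>x. F (apply_bcontfun \<phi> x) x)"
    for \<phi> :: "real \<Rightarrow>\<^sub>C complex"
  proof -
    have "continuous_on UNIV (\<lambda>x. F (apply_bcontfun \<phi> x) x)"
      using continuous_on_compose2[OF cont, of UNIV "\<lambda>x. (\<phi>, x)"] by (simp add: continuous_on_Pair)
    then have "set_integrable lborel {0..L} (\<lambda>x. F (apply_bcontfun \<phi> x) x)"
      by (intro borel_integrable_atLeastAtMost') (auto intro: continuous_on_subset)
    from set_borel_integral_eq_integral(2)[OF this] show ?thesis
      unfolding circle_integral_eq[symmetric] circle_integral_def by simp
  qed
  moreover have "continuous_on UNIV (\<lambda>\<phi>::real \<Rightarrow>\<^sub>C complex. integral (cbox 0 L) (\<lambda>x. F (apply_bcontfun \<phi> x) x))"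
    by (intro integral_continuous_on_param) (use cont in \<open>auto intro: continuous_on_subset\<close>)
  ultimately show ?thesis by simp
qed

lemma continuous_fourier_coeff:
  "continuous_on UNIV (\<lambda>\<phi>. fourier_coeff L k (apply_bcontfun \<phi>))"
  unfolding fourier_coeff_eq
  by (intro continuous_circle_integral) (auto simp: split_beta intro!: continuous_intros)

lemma continuous_Lq_norm:
  assumes "q > 0"
  shows "continuous_on UNIV (\<lambda>\<phi>. Lq_norm L q (apply_bcontfun \<phi>))"
  unfolding Lq_norm_def circle_integral_eq
proof (intro continuous_on_powr' continuous_circle_integral)
  show "continuous_on UNIV (\<lambda>(z, x). cmod z powr q)"
    using assms unfolding split_beta by (intro continuous_on_powr' continuous_intros) auto
qed (use assms in \<open>auto intro: continuous_intros integral_nonneg_AE\<close>)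

lemma gaussian_measurable:
  fixes f :: "(real \<Rightarrow>\<^sub>C complex) \<Rightarrow> 'a::topological_space"
  assumes M: "is_gaussian_measure L m \<beta> M" and f: "continuous_on UNIV f"
  shows "f \<in> borel_measurable M"
proof -
  have "sets M = sets (restrict_space borel (circle_fun L))" using M by (simp add: is_gaussian_measure_def)
  moreover have "f \<in> borel_measurable (restrict_space borel (circle_fun L))"
    using f by (intro measurable_restrict_space1 borel_measurable_continuous_onI)
  ultimately show ?thesis by (simp cong: measurable_cong_sets)
qed

lemma space_gaussian:
  assumes M: "is_gaussian_measure L m \<beta> M"
  shows "space M = circle_fun L"
proof -
  have "sets M = sets (restrict_space borel (circle_fun L))" using M by (simp add: is_gaussian_measure_def)
  from sets_eq_imp_space_eq[OF this] show ?thesis by (simp add: space_restrict_space)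
qed

section \<open>Symmetric partial sums and their mean-square limits\<close>

definition symmetric_sum :: "real \<Rightarrow> (int \<Rightarrow> complex) \<Rightarrow> nat \<Rightarrow> real \<Rightarrow> complex" where
  "symmetric_sum L d N = fourier_sum L {- int N..int N} d"

definition square_sum :: "(int \<Rightarrow> complex) \<Rightarrow> nat \<Rightarrow> real" where
  "square_sum d N = (\<Sum>k\<in>{- int N..int N}. (cmod (d k))\<^sup>2)"

lemma square_sum_mono: "i \<le> j \<Longrightarrow> square_sum d i \<le> square_sum d j"
  unfolding square_sum_def by (intro sum_mono2) auto

lemma square_sum_nonneg: "0 \<le> square_sum d N"
  unfolding square_sum_def by (intro sum_nonneg) auto

lemma continuous_symmetric_sum [continuous_intros]:
  "continuous_on A f \<Longrightarrow> continuous_on A (\<lambda>x. symmetric_sum L d N (f x))"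
  unfolding symmetric_sum_def by (intro continuous_intros)

lemma borel_measurable_symmetric_sum [measurable]: "symmetric_sum L d N \<in> borel_measurable borel"
  by (intro borel_measurable_continuous_onI continuous_intros)

lemma integral_symmetric_sum_diff:
  assumes L: "L > 0"
  shows "(\<integral>x. (cmod (symmetric_sum L d i x - symmetric_sum L d j x))\<^sup>2 \<partial>circle_measure L) =
    \<bar>square_sum d i - square_sum d j\<bar>"
proof -
  have main: "(\<integral>x. (cmod (symmetric_sum L d i x - symmetric_sum L d j x))\<^sup>2 \<partial>circle_measure L) =
    square_sum d i - square_sum d j" if "j \<le> i" for i j
  proof -
    let ?D = "{- int i..int i} - {- int j..int j}"
    have sub: "{- int j..int j} \<subseteq> {- int i..int i}" using that by auto
    have "symmetric_sum L d i x - symmetric_sum L d j x = fourier_sum L ?D d x" for x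
      unfolding symmetric_sum_def fourier_sum_def using sub by (subst sum_diff) auto
    then have "(\<integral>x. (cmod (symmetric_sum L d i x - symmetric_sum L d j x))\<^sup>2 \<partial>circle_measure L) =
        (\<Sum>k\<in>?D. (cmod (d k))\<^sup>2)"
      using L by (simp add: parseval_fourier_sum)
    also have "\<dots> = square_sum d i - square_sum d j"
      unfolding square_sum_def using sub by (subst sum_diff) auto
    finally show ?thesis .
  qed
  show ?thesis
  proof (cases "j \<le> i")
    case True
    then show ?thesis using main[of j i] square_sum_mono[of j i d] by simp
  next
    case False
    then show ?thesis using main[of i j] square_sum_mono[of i j d]
      by (simp add: norm_minus_commute[of "symmetric_sum L d i _"])
  qed
qed

lemma integral_symmetric_sum:
  assumes L: "L > 0"
  shows "(\<integral>x. (cmod (symmetric_sum L d N x))\<^sup>2 \<partial>circle_measure L) = square_sum d N"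
  using L by (simp add: symmetric_sum_def square_sum_def parseval_fourier_sum)

text \<open>Two partial sums at squared distance below 1 from the same limit have squared distance
  at most 2 + 2 from each other. The bound is taken in the natural numbers so that the condition
  becomes a countable union over B.\<close>

lemma bounded_of_L2_limit:
  assumes L: "L > 0" and [measurable]: "\<psi> \<in> borel_measurable borel"
    and lim: "(\<lambda>N. \<integral>\<^sup>+x. ennreal ((cmod (\<psi> x - symmetric_sum L d N x))\<^sup>2) \<partial>circle_measure L) \<longlonglongrightarrow> 0"
  shows "\<exists>B::nat. \<forall>N. square_sum d N \<le> real B"
proof -
  have "\<forall>\<^sub>F N in sequentially. (\<integral>\<^sup>+x. ennreal ((cmod (\<psi> x - symmetric_sum L d N x))\<^sup>2) \<partial>circle_measure L) < 1"
    by (rule order_tendstoD[OF lim]) simp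
  then obtain N0 where N0: "\<And>N. N \<ge> N0 \<Longrightarrow>
      (\<integral>\<^sup>+x. ennreal ((cmod (\<psi> x - symmetric_sum L d N x))\<^sup>2) \<partial>circle_measure L) < 1"
    by (auto simp: eventually_sequentially)
  have bound: "square_sum d N \<le> square_sum d N0 + 4" if "N \<ge> N0" for N
  proof -
    have "ennreal \<bar>square_sum d N - square_sum d N0\<bar> =
        ennreal (\<integral>x. (cmod (symmetric_sum L d N x - symmetric_sum L d N0 x))\<^sup>2 \<partial>circle_measure L)"
      by (simp add: integral_symmetric_sum_diff[OF L])
    also have "\<dots> = (\<integral>\<^sup>+x. ennreal ((cmod (symmetric_sum L d N x - symmetric_sum L d N0 x))\<^sup>2) \<partial>circle_measure L)"
      by (intro nn_integral_eq_integral[symmetric] integrable_circle continuous_intros) auto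
    also have "\<dots> \<le> (\<integral>\<^sup>+x. 2 * ennreal ((cmod (\<psi> x - symmetric_sum L d N x))\<^sup>2) +
        2 * ennreal ((cmod (\<psi> x - symmetric_sum L d N0 x))\<^sup>2) \<partial>circle_measure L)"
    proof (rule nn_integral_mono)
      fix x
      define a b where "a = cmod (\<psi> x - symmetric_sum L d N x)" and "b = cmod (\<psi> x - symmetric_sum L d N0 x)"
      have "cmod (symmetric_sum L d N x - symmetric_sum L d N0 x) \<le> a + b"
        unfolding a_def b_def
        using norm_triangle_ineq4[of "\<psi> x - symmetric_sum L d N0 x" "\<psi> x - symmetric_sum L d N x"]
        by simp
      then have "(cmod (symmetric_sum L d N x - symmetric_sum L d N0 x))\<^sup>2 \<le> (a + b)\<^sup>2"
        by (intro power_mono) auto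
      also have "\<dots> \<le> 2 * a\<^sup>2 + 2 * b\<^sup>2"
        using zero_le_power2[of "a - b"] unfolding power2_diff power2_sum by linarith
      finally have "ennreal ((cmod (symmetric_sum L d N x - symmetric_sum L d N0 x))\<^sup>2) \<le> ennreal (2 * a\<^sup>2 + 2 * b\<^sup>2)"
        by (rule ennreal_leI)
      then show "ennreal ((cmod (symmetric_sum L d N x - symmetric_sum L d N0 x))\<^sup>2) \<le> 2 * ennreal (a\<^sup>2) + 2 * ennreal (b\<^sup>2)"
        by (simp add: ennreal_mult)
    qed
    also have "\<dots> = 2 * (\<integral>\<^sup>+x. ennreal ((cmod (\<psi> x - symmetric_sum L d N x))\<^sup>2) \<partial>circle_measure L) +
        2 * (\<integral>\<^sup>+x. ennreal ((cmod (\<psi> x - symmetric_sum L d N0 x))\<^sup>2) \<partial>circle_measure L)"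
      by (simp add: nn_integral_add nn_integral_cmult)
    also have "\<dots> \<le> 2 * 1 + 2 * 1"
      using less_imp_le[OF N0] that by (intro add_mono mult_left_mono) auto
    finally have "ennreal \<bar>square_sum d N - square_sum d N0\<bar> \<le> ennreal 4" by simp
    then have "\<bar>square_sum d N - square_sum d N0\<bar> \<le> 4" by (subst (asm) ennreal_le_iff) auto
    then show ?thesis by linarith
  qed
  have "square_sum d N \<le> square_sum d N0 + 4" for N
  proof (cases "N \<ge> N0")
    case False
    then show ?thesis using square_sum_mono[of N N0 d] by simp
  qed (rule bound)
  moreover obtain B :: nat where "square_sum d N0 + 4 \<le> real B" using real_arch_simple by blast
  ultimately show ?thesis using order_trans by blast
qed

text \<open>Riesz-Fischer: bounded increasing square sums are Cauchy, so the partial sums are Cauchy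
  in L^1 and a subsequence converges almost everywhere. Fatou's lemma then gives mean-square
  convergence of the whole sequence to that limit.\<close>

lemma L2_limit_of_bounded:
  assumes L: "L > 0" and B: "\<And>N. square_sum d N \<le> B"
  shows "\<exists>\<psi> \<in> borel_measurable borel.
    (\<lambda>N. \<integral>\<^sup>+x. ennreal ((cmod (\<psi> x - symmetric_sum L d N x))\<^sup>2) \<partial>circle_measure L) \<longlonglongrightarrow> 0"
proof -
  define T where "T = symmetric_sum L d"
  have T [continuous_intros]: "continuous_on UNIV (T N)" for N unfolding T_def by (intro continuous_intros)
  have [measurable]: "T N \<in> borel_measurable borel" for N unfolding T_def by measurable
  have "incseq (square_sum d)" by (simp add: incseq_def square_sum_mono)
  then have "convergent (square_sum d)"
    using incseq_convergent[of "square_sum d" B] B by (metis convergentI)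
  then have Cauchy: "Cauchy (square_sum d)" by (rule convergent_Cauchy)
  have L1: "(\<integral>x. cmod (T i x - T j x) \<partial>circle_measure L)\<^sup>2 \<le> L * \<bar>square_sum d i - square_sum d j\<bar>" for i j
  proof -
    have "integrable (circle_measure L) (\<lambda>x. (cmod (T i x - T j x))\<^sup>2)"
      by (intro integrable_circle continuous_intros)
    moreover have "(\<lambda>x. T i x - T j x) \<in> borel_measurable (circle_measure L)" by measurable
    ultimately show ?thesis
      using integral_abs_squared_le(2)[OF L, of "\<lambda>x. T i x - T j x"]
      by (simp add: T_def integral_symmetric_sum_diff[OF L])
  qed
  have "\<exists>N. \<forall>i\<ge>N. \<forall>j\<ge>N. (\<integral>x. norm (T i x - T j x) \<partial>circle_measure L) < e" if "e > 0" for e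
  proof -
    have "0 < e\<^sup>2 / L" using that L by simp
    from metric_CauchyD[OF Cauchy this]
    obtain N where N: "\<And>i j. i \<ge> N \<Longrightarrow> j \<ge> N \<Longrightarrow> dist (square_sum d i) (square_sum d j) < e\<^sup>2 / L"
      by blast
    have "(\<integral>x. norm (T i x - T j x) \<partial>circle_measure L) < e" if "i \<ge> N" "j \<ge> N" for i j
    proof (rule power2_less_imp_less)
      have "L * \<bar>square_sum d i - square_sum d j\<bar> < L * (e\<^sup>2 / L)"
        using N[OF that] L by (intro mult_strict_left_mono) (auto simp: dist_real_def)
      then show "(\<integral>x. norm (T i x - T j x) \<partial>circle_measure L)\<^sup>2 < e\<^sup>2"
        using L1[of i j] L by simp
    qed (use \<open>e > 0\<close> in auto)
    then show ?thesis by blast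
  qed
  then obtain r where r: "strict_mono r" "AE x in circle_measure L. Cauchy (\<lambda>i. T (r i) x)"
    using cauchy_L1_AE_cauchy_subseq[of "circle_measure L" T]
    by (metis T integrable_circle)
  \<comment> \<open>Where the subsequence diverges \<open>lim\<close> is an unspecified value, yet
    \<psi> is Borel on the whole line.\<close>
  define \<psi> where "\<psi> x = lim (\<lambda>i. T (r i) x)" for x
  have [measurable]: "\<psi> \<in> borel_measurable borel"
    unfolding \<psi>_def[abs_def] by (rule borel_measurable_lim_metric) measurable
  have lim: "AE x in circle_measure L. (\<lambda>i. T (r i) x) \<longlonglongrightarrow> \<psi> x"
    using r(2) unfolding \<psi>_def
    by eventually_elim (simp add: Cauchy_convergent_iff convergent_LIMSEQ_iff)
  have bound: "(\<integral>\<^sup>+x. ennreal ((cmod (\<psi> x - T N x))\<^sup>2) \<partial>circle_measure L) \<le> ennreal e"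
    if N: "\<And>i j. i \<ge> N \<Longrightarrow> j \<ge> N \<Longrightarrow> \<bar>square_sum d i - square_sum d j\<bar> \<le> e" for N e
  proof -
    have "AE x in circle_measure L. ennreal ((cmod (\<psi> x - T N x))\<^sup>2) \<le>
        liminf (\<lambda>i. ennreal ((cmod (T (r i) x - T N x))\<^sup>2))"
      using lim
    proof eventually_elim
      case (elim x)
      then have "(\<lambda>i. ennreal ((cmod (T (r i) x - T N x))\<^sup>2)) \<longlonglongrightarrow> ennreal ((cmod (\<psi> x - T N x))\<^sup>2)"
        by (intro tendsto_intros tendsto_ennrealI)
      from lim_imp_Liminf[OF _ this] show ?case by simp
    qed
    then have "(\<integral>\<^sup>+x. ennreal ((cmod (\<psi> x - T N x))\<^sup>2) \<partial>circle_measure L) \<le>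
        (\<integral>\<^sup>+x. liminf (\<lambda>i. ennreal ((cmod (T (r i) x - T N x))\<^sup>2)) \<partial>circle_measure L)"
      by (rule nn_integral_mono_AE)
    also have "\<dots> \<le> liminf (\<lambda>i. \<integral>\<^sup>+x. ennreal ((cmod (T (r i) x - T N x))\<^sup>2) \<partial>circle_measure L)"
      by (intro nn_integral_liminf) measurable
    also have "\<dots> \<le> liminf (\<lambda>i. ennreal e)"
    proof (rule Liminf_mono)
      have "(\<integral>\<^sup>+x. ennreal ((cmod (T (r i) x - T N x))\<^sup>2) \<partial>circle_measure L) \<le> ennreal e" if "i \<ge> N" for i
      proof -
        have "(\<integral>\<^sup>+x. ennreal ((cmod (T (r i) x - T N x))\<^sup>2) \<partial>circle_measure L) =
            ennreal (\<integral>x. (cmod (T (r i) x - T N x))\<^sup>2 \<partial>circle_measure L)"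
          by (intro nn_integral_eq_integral integrable_circle continuous_intros) auto
        also have "\<dots> \<le> ennreal e"
          using N[of "r i" N] that strict_mono_imp_increasing[OF r(1), of i]
          by (intro ennreal_leI) (simp add: T_def integral_symmetric_sum_diff[OF L])
        finally show ?thesis .
      qed
      then show "\<forall>\<^sub>F i in sequentially. (\<integral>\<^sup>+x. ennreal ((cmod (T (r i) x - T N x))\<^sup>2) \<partial>circle_measure L) \<le> ennreal e"
        by (auto simp: eventually_sequentially)
    qed
    also have "\<dots> = ennreal e" by (simp add: Liminf_const)
    finally show ?thesis .
  qed
  have "(\<lambda>N. \<integral>\<^sup>+x. ennreal ((cmod (\<psi> x - T N x))\<^sup>2) \<partial>circle_measure L) \<longlonglongrightarrow> 0"
  proof (rule order_tendstoI)
    fix a :: ennreal assume "0 < a"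
    then obtain e where e: "0 < e" "ennreal e < a"
      by (metis dense ennreal_cases ennreal_less_zero_iff order_less_imp_not_less top_greatest leD)
    obtain N0 where "\<And>i j. i \<ge> N0 \<Longrightarrow> j \<ge> N0 \<Longrightarrow> dist (square_sum d i) (square_sum d j) < e"
      using metric_CauchyD[OF Cauchy e(1)] by blast
    then have "(\<integral>\<^sup>+x. ennreal ((cmod (\<psi> x - T N x))\<^sup>2) \<partial>circle_measure L) \<le> ennreal e" if "N \<ge> N0" for N
      using that by (intro bound less_imp_le) (simp add: dist_real_def[symmetric])
    then have "(\<integral>\<^sup>+x. ennreal ((cmod (\<psi> x - T N x))\<^sup>2) \<partial>circle_measure L) < a" if "N \<ge> N0" for N
      using that e(2) by (blast intro: order.strict_trans1)
    then show "\<forall>\<^sub>F N in sequentially. (\<integral>\<^sup>+x. ennreal ((cmod (\<psi> x - T N x))\<^sup>2) \<partial>circle_measure L) < a"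
      by (auto simp: eventually_sequentially)
  qed simp
  then show ?thesis unfolding T_def by (intro bexI[of _ \<psi>]) auto
qed

text \<open>On the period g is bounded, so the error is at most a multiple of the L^1 distance and
  hence of the L^2 distance. Any L^2 limit gives the same value, which removes the dependence on a
  representative.\<close>

lemma integral_mult_tendsto:
  assumes L: "L > 0" and g: "continuous_on UNIV g" and [measurable]: "\<psi> \<in> borel_measurable borel"
    and lim: "(\<lambda>N. \<integral>\<^sup>+x. ennreal ((cmod (\<psi> x - symmetric_sum L d N x))\<^sup>2) \<partial>circle_measure L) \<longlonglongrightarrow> 0"
  shows "(\<lambda>N. \<integral>x. g x * symmetric_sum L d N x \<partial>circle_measure L) \<longlonglongrightarrow> (\<integral>x. g x * \<psi> x \<partial>circle_measure L)"
proof -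
  define T where "T = symmetric_sum L d"
  have T [continuous_intros]: "continuous_on UNIV (T N)" for N unfolding T_def by (intro continuous_intros)
  have [measurable]: "T N \<in> borel_measurable borel" "g \<in> borel_measurable borel" for N
    unfolding T_def using g by (auto intro: borel_measurable_continuous_onI)
  note [continuous_intros] = g
  define D where "D N = (\<integral>\<^sup>+x. ennreal ((cmod (\<psi> x - T N x))\<^sup>2) \<partial>circle_measure L)" for N
  have D: "D \<longlonglongrightarrow> 0" using lim by (simp add: D_def[abs_def] T_def)
  obtain B where B: "B > 0" "\<And>x. x \<in> {0..L} \<Longrightarrow> cmod (g x) \<le> B"
  proof -
    have "bounded (g ` {0..L})"
      using g by (intro compact_imp_bounded compact_continuous_image) (auto intro: continuous_on_subset)
    then show ?thesis using that by (auto simp: bounded_pos)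
  qed
  \<comment> \<open>Finiteness of \<open>D N\<close> makes the difference square integrable, so that
    its Bochner integrals are meaningful.\<close>
  have "\<forall>\<^sub>F N in sequentially. D N < 1" by (rule order_tendstoD[OF D]) simp
  moreover have "cmod ((\<integral>x. g x * T N x \<partial>circle_measure L) - (\<integral>x. g x * \<psi> x \<partial>circle_measure L)) \<le>
      B * sqrt (L * enn2real (D N))" if DN: "D N < 1" for N
  proof -
    have int2: "integrable (circle_measure L) (\<lambda>x. (cmod (\<psi> x - T N x))\<^sup>2)"
      using DN unfolding D_def by (intro integrableI_nonneg) (auto intro: order.strict_trans)
    have D_eq: "(\<integral>x. (cmod (\<psi> x - T N x))\<^sup>2 \<partial>circle_measure L) = enn2real (D N)"
      unfolding D_def by (intro integral_eq_nn_integral) auto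
    have meas: "(\<lambda>x. \<psi> x - T N x) \<in> borel_measurable (circle_measure L)" by measurable
    note int1 = integral_abs_squared_le(1)[OF L meas int2]
    have le: "(\<integral>x. cmod (\<psi> x - T N x) \<partial>circle_measure L) \<le> sqrt (L * enn2real (D N))"
      using integral_abs_squared_le(2)[OF L meas int2] unfolding D_eq by (rule real_le_rsqrt)
    have AEB: "AE x in circle_measure L. cmod (g x) \<le> B" using B by (intro AE_I2) simp
    have intB: "integrable (circle_measure L) (\<lambda>x. B * cmod (\<psi> x - T N x))" using int1 by simp
    have intd: "integrable (circle_measure L) (\<lambda>x. g x * (\<psi> x - T N x))"
      by (rule Bochner_Integration.integrable_bound[OF intB])
        (use AEB B in \<open>auto elim!: eventually_mono simp: norm_mult intro!: mult_right_mono\<close>)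
    have intT: "integrable (circle_measure L) (\<lambda>x. g x * T N x)"
      by (intro integrable_circle continuous_intros)
    have "integrable (circle_measure L) (\<lambda>x. g x * (\<psi> x - T N x) + g x * T N x)"
      by (intro Bochner_Integration.integrable_add intd intT)
    then have int\<psi>: "integrable (circle_measure L) (\<lambda>x. g x * \<psi> x)" by (simp add: algebra_simps)
    have "(\<integral>x. g x * \<psi> x \<partial>circle_measure L) - (\<integral>x. g x * T N x \<partial>circle_measure L) =
        (\<integral>x. g x * (\<psi> x - T N x) \<partial>circle_measure L)"
      using int\<psi> intT by (simp add: right_diff_distrib)
    then have "cmod ((\<integral>x. g x * T N x \<partial>circle_measure L) - (\<integral>x. g x * \<psi> x \<partial>circle_measure L)) =
        cmod (\<integral>x. g x * (\<psi> x - T N x) \<partial>circle_measure L)" by (simp add: norm_minus_commute)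
    also have "\<dots> \<le> (\<integral>x. cmod (g x * (\<psi> x - T N x)) \<partial>circle_measure L)" by (rule integral_norm_bound)
    also have "\<dots> \<le> (\<integral>x. B * cmod (\<psi> x - T N x) \<partial>circle_measure L)"
      by (rule integral_mono[OF integrable_norm[OF intd] intB])
        (use B in \<open>auto simp: norm_mult intro!: mult_right_mono\<close>)
    also have "\<dots> \<le> B * sqrt (L * enn2real (D N))" using le B by simp
    finally show ?thesis .
  qed
  ultimately have ev: "\<forall>\<^sub>F N in sequentially. norm ((\<integral>x. g x * T N x \<partial>circle_measure L) - (\<integral>x. g x * \<psi> x \<partial>circle_measure L)) \<le>
      B * sqrt (L * enn2real (D N))" by (rule eventually_mono)
  have "(\<lambda>N. enn2real (D N)) \<longlonglongrightarrow> 0" using tendsto_enn2real[of D 0] D by simp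
  then have "(\<lambda>N. B * sqrt (L * enn2real (D N))) \<longlonglongrightarrow> B * sqrt (L * 0)"
    by (intro tendsto_mult tendsto_const tendsto_real_sqrt)
  then have "(\<lambda>N. B * sqrt (L * enn2real (D N))) \<longlonglongrightarrow> 0" by simp
  from Lim_null_comparison[OF ev this] show ?thesis by (simp add: LIM_zero_iff T_def)
qed

section \<open>The cubic pairing with the elliptic power: estimates and measurability\<close>

lemma integral_Cauchy_Schwarz:
  fixes f g :: "real \<Rightarrow> real"
  assumes f: "continuous_on UNIV f" "\<And>x. 0 \<le> f x" and g: "continuous_on UNIV g" "\<And>x. 0 \<le> g x"
  shows "(\<integral>x. f x * g x \<partial>circle_measure L)\<^sup>2 \<le>
    (\<integral>x. (f x)\<^sup>2 \<partial>circle_measure L) * (\<integral>x. (g x)\<^sup>2 \<partial>circle_measure L)"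
proof -
  note [continuous_intros] = f(1) g(1)
  have [measurable]: "f \<in> borel_measurable borel" "g \<in> borel_measurable borel"
    using f g by (auto intro: borel_measurable_continuous_onI)
  have eq: "(\<integral>\<^sup>+x. ennreal (h x) \<partial>circle_measure L) = ennreal (\<integral>x. h x \<partial>circle_measure L)"
    if "continuous_on UNIV h" "\<And>x. 0 \<le> h x" for h
    using that by (intro nn_integral_eq_integral integrable_circle) auto
  have "(\<integral>\<^sup>+x. ennreal (f x) * ennreal (g x) \<partial>circle_measure L)\<^sup>2 \<le>
      (\<integral>\<^sup>+x. (ennreal (f x))\<^sup>2 \<partial>circle_measure L) * (\<integral>\<^sup>+x. (ennreal (g x))\<^sup>2 \<partial>circle_measure L)"
    by (rule Cauchy_Schwarz_nn_integral) measurable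
  also have "(\<lambda>x. ennreal (f x) * ennreal (g x)) = (\<lambda>x. ennreal (f x * g x))"
    using f g by (simp add: ennreal_mult)
  also have "(\<lambda>x. (ennreal (f x))\<^sup>2) = (\<lambda>x. ennreal ((f x)\<^sup>2))"
    using f by (simp add: ennreal_power)
  also have "(\<lambda>x. (ennreal (g x))\<^sup>2) = (\<lambda>x. ennreal ((g x)\<^sup>2))"
    using g by (simp add: ennreal_power)
  finally have "(ennreal (\<integral>x. f x * g x \<partial>circle_measure L))\<^sup>2 \<le>
      ennreal (\<integral>x. (f x)\<^sup>2 \<partial>circle_measure L) * ennreal (\<integral>x. (g x)\<^sup>2 \<partial>circle_measure L)"
    using f g by (subst (asm) (1 2 3) eq) (auto intro!: continuous_intros)
  moreover have "0 \<le> (\<integral>x. f x * g x \<partial>circle_measure L)" "0 \<le> (\<integral>x. (f x)\<^sup>2 \<partial>circle_measure L)"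
    "0 \<le> (\<integral>x. (g x)\<^sup>2 \<partial>circle_measure L)"
    using f g by (auto intro!: integral_nonneg_AE)
  ultimately show ?thesis by (simp add: ennreal_power flip: ennreal_mult)
qed

text \<open>After Cauchy-Schwarz the product sqrt (X Y) is split by Young's inequality with
  exponents 3/2 and 3, comparing Y with sqrt X. The split is uneven on purpose: the later bound on X
  contains G^(21/20), and the power 3/4 brings this below 1.\<close>

lemma cubic_pairing_bound:
  assumes \<phi>: "continuous_on UNIV \<phi>" and T: "continuous_on UNIV T"
  shows "cmod (\<integral>x. of_real ((cmod (\<phi> x))\<^sup>2) * cnj (\<phi> x) * T x \<partial>circle_measure L) \<le>
    (\<integral>x. cmod (\<phi> x) powr 6 \<partial>circle_measure L) powr (3 / 4) + (\<integral>x. (cmod (T x))\<^sup>2 \<partial>circle_measure L) powr (3 / 2)"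
proof -
  note [continuous_intros] = \<phi> T
  define X where "X = (\<integral>x. cmod (\<phi> x) powr 6 \<partial>circle_measure L)"
  define Y where "Y = (\<integral>x. (cmod (T x))\<^sup>2 \<partial>circle_measure L)"
  have XY: "0 \<le> X" "0 \<le> Y" unfolding X_def Y_def by (auto intro!: integral_nonneg_AE)
  have "cmod (\<integral>x. of_real ((cmod (\<phi> x))\<^sup>2) * cnj (\<phi> x) * T x \<partial>circle_measure L) \<le>
      (\<integral>x. cmod (of_real ((cmod (\<phi> x))\<^sup>2) * cnj (\<phi> x) * T x) \<partial>circle_measure L)"
    by (rule integral_norm_bound)
  also have "\<dots> = (\<integral>x. (cmod (\<phi> x)) ^ 3 * cmod (T x) \<partial>circle_measure L)"
    by (simp add: norm_mult norm_power power2_eq_square power3_eq_cube)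
  also have "\<dots> \<le> sqrt (X * Y)"
  proof (rule real_le_rsqrt)
    have "(\<integral>x. (cmod (\<phi> x)) ^ 3 * cmod (T x) \<partial>circle_measure L)\<^sup>2 \<le>
      (\<integral>x. ((cmod (\<phi> x)) ^ 3)\<^sup>2 \<partial>circle_measure L) * Y"
      unfolding Y_def by (rule integral_Cauchy_Schwarz) (auto intro!: continuous_intros)
    also have "(\<lambda>x. ((cmod (\<phi> x)) ^ 3)\<^sup>2) = (\<lambda>x. cmod (\<phi> x) powr 6)"
      by (simp flip: power_mult)
    finally show "(\<integral>x. (cmod (\<phi> x)) ^ 3 * cmod (T x) \<partial>circle_measure L)\<^sup>2 \<le> X * Y" by (simp add: X_def)
  qed
  also have "\<dots> \<le> X powr (3 / 4) + Y powr (3 / 2)"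
  proof (cases "Y \<le> X powr (1 / 2)")
    case True
    have "sqrt (X * Y) = X powr (1 / 2) * Y powr (1 / 2)"
      using XY by (simp add: real_sqrt_mult powr_half_sqrt)
    also have "\<dots> \<le> X powr (1 / 2) * (X powr (1 / 2)) powr (1 / 2)"
      using True XY by (intro mult_left_mono powr_mono2) auto
    also have "\<dots> = X powr (3 / 4)" by (simp add: powr_powr flip: powr_add)
    finally show ?thesis by (simp add: add_increasing2)
  next
    case False
    then have "(X powr (1 / 2)) \<le> Y" by simp
    then have "sqrt X \<le> Y" using XY by (simp add: powr_half_sqrt)
    then have "sqrt (X * Y) \<le> Y * Y powr (1 / 2)"
      using XY by (simp add: real_sqrt_mult powr_half_sqrt mult_right_mono)
    also have "\<dots> = Y powr (1 + 1 / 2)" using XY by (subst powr_add) simp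
    finally have "sqrt (X * Y) \<le> Y powr (3 / 2)" by simp
    then show ?thesis by (simp add: add_increasing)
  qed
  finally show ?thesis by (simp add: X_def Y_def)
qed

definition elliptic_coeff :: "real \<Rightarrow> real \<Rightarrow> real \<Rightarrow> (real \<Rightarrow> complex) \<Rightarrow> int \<Rightarrow> complex" where
  "elliptic_coeff L m \<gamma> \<phi> k = of_real (eigval L m k powr \<gamma>) * fourier_coeff L k \<phi>"

lemma is_elliptic_power_iff:
  "is_elliptic_power L m \<gamma> \<phi> \<psi> \<longleftrightarrow> \<psi> \<in> borel_measurable borel \<and>
    (\<lambda>N. \<integral>\<^sup>+x. ennreal ((cmod (\<psi> x - symmetric_sum L (elliptic_coeff L m \<gamma> \<phi>) N x))\<^sup>2) \<partial>circle_measure L) \<longlonglongrightarrow> 0"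
  unfolding is_elliptic_power_def nn_integral_circle symmetric_sum_def fourier_sum_def elliptic_coeff_def by simp

text \<open>Exactly characterising the domain makes it measurable; the Gaussian measure need not be complete, so
  an almost sure statement would not suffice.\<close>

lemma elliptic_power_exists_iff:
  assumes "L > 0"
  shows "(\<exists>\<psi>. is_elliptic_power L m \<gamma> \<phi> \<psi>) \<longleftrightarrow> (\<exists>B::nat. \<forall>N. square_sum (elliptic_coeff L m \<gamma> \<phi>) N \<le> real B)"
proof
  assume "\<exists>\<psi>. is_elliptic_power L m \<gamma> \<phi> \<psi>"
  then show "\<exists>B::nat. \<forall>N. square_sum (elliptic_coeff L m \<gamma> \<phi>) N \<le> real B"
    unfolding is_elliptic_power_iff using bounded_of_L2_limit[OF assms] by blast
next
  assume "\<exists>B::nat. \<forall>N. square_sum (elliptic_coeff L m \<gamma> \<phi>) N \<le> real B"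
  then show "\<exists>\<psi>. is_elliptic_power L m \<gamma> \<phi> \<psi>"
    unfolding is_elliptic_power_iff using L2_limit_of_bounded[OF assms] by blast
qed

definition cubic_pairing :: "real \<Rightarrow> (real \<Rightarrow> complex) \<Rightarrow> (real \<Rightarrow> complex) \<Rightarrow> complex" where
  "cubic_pairing L \<phi> \<psi> = circle_integral L (\<lambda>x. of_real ((cmod (\<phi> x))\<^sup>2) * cnj (\<phi> x) * \<psi> x)"

text \<open>The limit depends on \<phi> only through explicit coefficients, however the Hilbert
  choice in \<open>elliptic_power\<close> falls. The \<open>if\<close> reproduces the value 0 off
  the domain, so convergence holds for every continuous \<phi> and not just almost surely.\<close>

lemma cubic_pairing_elliptic_power_tendsto:
  assumes L: "L > 0" and \<phi>: "continuous_on UNIV \<phi>"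
  shows "(\<lambda>N. if \<exists>B::nat. \<forall>N. square_sum (elliptic_coeff L m \<gamma> \<phi>) N \<le> real B
      then cubic_pairing L \<phi> (symmetric_sum L (elliptic_coeff L m \<gamma> \<phi>) N) else 0)
    \<longlonglongrightarrow> cubic_pairing L \<phi> (elliptic_power L m \<gamma> \<phi>)"
proof (cases "\<exists>\<psi>. is_elliptic_power L m \<gamma> \<phi> \<psi>")
  case True
  then have "is_elliptic_power L m \<gamma> \<phi> (elliptic_power L m \<gamma> \<phi>)"
    using someI_ex[OF True] by (simp add: elliptic_power_def)
  note * = this[unfolded is_elliptic_power_iff]
  have "(\<lambda>N. cubic_pairing L \<phi> (symmetric_sum L (elliptic_coeff L m \<gamma> \<phi>) N))
    \<longlonglongrightarrow> cubic_pairing L \<phi> (elliptic_power L m \<gamma> \<phi>)"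
    unfolding cubic_pairing_def circle_integral_eq
    by (intro integral_mult_tendsto L conjunct1[OF *] conjunct2[OF *] continuous_intros \<phi>)
  then show ?thesis using True by (simp add: elliptic_power_exists_iff[OF L])
next
  case False
  then have "elliptic_power L m \<gamma> \<phi> = (\<lambda>_. 0)" by (simp add: elliptic_power_def)
  moreover have "\<not> (\<exists>B::nat. \<forall>N. square_sum (elliptic_coeff L m \<gamma> \<phi>) N \<le> real B)"
    using False by (simp only: elliptic_power_exists_iff[OF L] not_False_eq_True)
  ultimately show ?thesis by (simp only: if_False) (simp add: cubic_pairing_def circle_integral_eq)
qed

lemma cubic_pairing_symmetric_sum:
  assumes \<phi>: "continuous_on UNIV \<phi>"
  shows "cubic_pairing L \<phi> (symmetric_sum L d N) =
    (\<Sum>k\<in>{- int N..int N}. d k * cubic_pairing L \<phi> (fourier_mode L k))"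
proof -
  have "integrable (circle_measure L) (\<lambda>x. of_real ((cmod (\<phi> x))\<^sup>2) * cnj (\<phi> x) * fourier_mode L k x)" for k
    by (intro integrable_circle continuous_intros \<phi>)
  then show ?thesis
    by (simp add: cubic_pairing_def circle_integral_eq symmetric_sum_def fourier_sum_def sum_distrib_left
        Bochner_Integration.integral_sum mult.left_commute[of _ "d _"])
qed

lemma measurable_cubic_pairing_elliptic_power:
  assumes L: "L > 0" and M: "is_gaussian_measure L m \<beta> M"
  shows "(\<lambda>\<phi>. cmod (cubic_pairing L (apply_bcontfun \<phi>) (elliptic_power L m \<gamma> (apply_bcontfun \<phi>)))) \<in> borel_measurable M"
proof -
  let ?d = "\<lambda>\<phi>. elliptic_coeff L m \<gamma> (apply_bcontfun \<phi>)"
  have [measurable]: "(\<lambda>\<phi>. fourier_coeff L k (apply_bcontfun \<phi>)) \<in> borel_measurable M" for k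
    by (rule gaussian_measurable[OF M continuous_fourier_coeff])
  have [measurable]: "(\<lambda>\<phi>. cubic_pairing L (apply_bcontfun \<phi>) (fourier_mode L k)) \<in> borel_measurable M" for k
    unfolding cubic_pairing_def circle_integral_eq
    by (rule gaussian_measurable[OF M], rule continuous_circle_integral)
      (auto simp: split_beta intro!: continuous_intros)
  have [measurable]: "(\<lambda>\<phi>. ?d \<phi> k) \<in> borel_measurable M" for k
    unfolding elliptic_coeff_def by measurable
  have [measurable]: "(\<lambda>\<phi>. square_sum (?d \<phi>) N) \<in> borel_measurable M" for N
    unfolding square_sum_def by measurable
  have [measurable]: "(\<lambda>\<phi>. cubic_pairing L (apply_bcontfun \<phi>) (symmetric_sum L (?d \<phi>) N)) \<in> borel_measurable M" for N
    by (subst cubic_pairing_symmetric_sum) (auto intro!: borel_measurable_sum borel_measurable_times)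
  \<comment> \<open>The case distinction is a union over B of intersections over N of measurable
    inequalities, so the approximants are measurable and so is their pointwise limit.\<close>
  show ?thesis
  proof (rule borel_measurable_LIMSEQ_real)
    show "(\<lambda>N. cmod (if \<exists>B::nat. \<forall>N. square_sum (?d \<phi>) N \<le> real B
      then cubic_pairing L (apply_bcontfun \<phi>) (symmetric_sum L (?d \<phi>) N) else 0))
      \<longlonglongrightarrow> cmod (cubic_pairing L (apply_bcontfun \<phi>) (elliptic_power L m \<gamma> (apply_bcontfun \<phi>)))" for \<phi>
      by (intro tendsto_norm cubic_pairing_elliptic_power_tendsto L) simp
  qed measurable
qed

text \<open>On block j the squared multiplier is of order 2^(4 \<gamma> j). In
  \<open>dyadic_sum_bound\<close> with p = 2, e = 4 \<gamma> and s = 1/4 the condition e < p s reads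
  4 \<gamma> < 1/2, which is \<gamma> < 1/8.\<close>

lemma square_sum_elliptic_bound:
  assumes L: "L > 0" and m: "m > 0" and \<gamma>: "\<gamma> < 1 / 8" and K: "K \<ge> 0"
  shows "\<exists>C\<ge>0. \<forall>\<phi> G N. continuous_on UNIV \<phi> \<longrightarrow> 0 \<le> G \<longrightarrow>
      (\<forall>j. (block_norm (\<lambda>k. fourier_coeff L k \<phi>) j)\<^sup>2 \<le> K * (1 / 2 ^ j + G / 4 ^ j)) \<longrightarrow>
      square_sum (elliptic_coeff L m \<gamma> \<phi>) N \<le> C * (1 + Lq_norm L 2 \<phi> powr (3 / 2) * G powr (1 / 4))"
proof -
  define c1 where "c1 = min (m\<^sup>2) ((pi / L)\<^sup>2)"
  define c2 where "c2 = (2 * pi / L)\<^sup>2 + m\<^sup>2"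
  \<comment> \<open>The upper eigenvalue bound serves \<gamma> \<ge> 0 and the lower one \<gamma> <
    0; the sum covers both signs.\<close>
  define C1 where "C1 = c1 powr (2 * \<gamma>) + c2 powr (2 * \<gamma>)"
  have c: "c1 > 0" "c2 > 0" using L m by (auto simp: c1_def c2_def add_nonneg_pos)
  have C1: "C1 \<ge> 0" by (simp add: C1_def)
  have eig: "eigval L m k powr (2 * \<gamma>) \<le> C1 * 2 powr (real j * (4 * \<gamma>))" if k: "k \<in> dyadic_block j" for k j
  proof -
    have b: "c1 * 4 ^ j \<le> eigval L m k" "eigval L m k \<le> c2 * 4 ^ j"
      using eigval_dyadic_bounds[OF L m k] by (simp_all add: c1_def c2_def)
    have pow: "(a * 4 ^ j) powr (2 * \<gamma>) = a powr (2 * \<gamma>) * 2 powr (real j * (4 * \<gamma>))" for a :: real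
    proof -
      have "(4::real) ^ j = 2 powr (2 * real j)" by (simp add: powr_realpow flip: powr_powr)
      then show ?thesis by (simp add: powr_mult powr_powr mult_ac)
    qed
    have "eigval L m k powr (2 * \<gamma>) \<le> max ((c1 * 4 ^ j) powr (2 * \<gamma>)) ((c2 * 4 ^ j) powr (2 * \<gamma>))"
    proof (cases "\<gamma> \<ge> 0")
      case True
      then have "eigval L m k powr (2 * \<gamma>) \<le> (c2 * 4 ^ j) powr (2 * \<gamma>)"
        using b m by (intro powr_mono2) (auto intro: less_imp_le eigval_pos)
      then show ?thesis by simp
    next
      case False
      then have "eigval L m k powr (2 * \<gamma>) \<le> (c1 * 4 ^ j) powr (2 * \<gamma>)"
        using b c by (intro powr_mono2') auto
      then show ?thesis by simp
    qed
    also have "\<dots> \<le> C1 * 2 powr (real j * (4 * \<gamma>))"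
      unfolding pow C1_def by (intro max.boundedI mult_right_mono) auto
    finally show ?thesis .
  qed
  obtain C2 where C2: "C2 \<ge> 0" "\<And>b N G J. 0 \<le> G \<Longrightarrow>
      (\<And>j::nat. 0 \<le> b j \<and> b j \<le> N \<and> (b j)\<^sup>2 \<le> K * (1 / 2 ^ j + G / 4 ^ j)) \<Longrightarrow>
      (\<Sum>j<J. 2 powr (real j * (4 * \<gamma>)) * b j powr 2) \<le> C2 * (1 + N powr (3 / 2) * G powr (1 / 4))"
    using dyadic_sum_bound[of "1 / 4" 2 "4 * \<gamma>" K] \<gamma> K by auto
  show ?thesis
  proof (intro exI[of _ "C1 * C2"] conjI allI impI)
    show "0 \<le> C1 * C2" using C1 C2 by simp
    fix \<phi> :: "real \<Rightarrow> complex" and G :: real and N :: nat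
    assume \<phi>: "continuous_on UNIV \<phi>" and G: "0 \<le> G"
      and b: "\<forall>j. (block_norm (\<lambda>k. fourier_coeff L k \<phi>) j)\<^sup>2 \<le> K * (1 / 2 ^ j + G / 4 ^ j)"
    let ?c = "\<lambda>k. fourier_coeff L k \<phi>"
    obtain J where J: "{- int N..int N} \<subseteq> dyadic_ball J" using subset_dyadic_ball[of N] by blast
    have "square_sum (elliptic_coeff L m \<gamma> \<phi>) N \<le> (\<Sum>k\<in>dyadic_ball J. (cmod (elliptic_coeff L m \<gamma> \<phi> k))\<^sup>2)"
      unfolding square_sum_def using J by (intro sum_mono2) auto
    also have "\<dots> = (\<Sum>j<Suc J. \<Sum>k\<in>dyadic_block j. (cmod (elliptic_coeff L m \<gamma> \<phi> k))\<^sup>2)"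
      by (rule sum_dyadic_ball)
    also have "\<dots> \<le> (\<Sum>j<Suc J. \<Sum>k\<in>dyadic_block j. C1 * 2 powr (real j * (4 * \<gamma>)) * (cmod (?c k))\<^sup>2)"
    proof (intro sum_mono)
      fix j k assume "k \<in> dyadic_block j"
      have "(eigval L m k powr \<gamma>)\<^sup>2 = eigval L m k powr (2 * \<gamma>)"
        by (simp only: power2_eq_square mult_2 powr_add)
      then have "(cmod (elliptic_coeff L m \<gamma> \<phi> k))\<^sup>2 = eigval L m k powr (2 * \<gamma>) * (cmod (?c k))\<^sup>2"
        by (simp add: elliptic_coeff_def norm_mult power_mult_distrib)
      also have "\<dots> \<le> C1 * 2 powr (real j * (4 * \<gamma>)) * (cmod (?c k))\<^sup>2"
        by (intro mult_right_mono eig) (use \<open>k \<in> dyadic_block j\<close> in auto)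
      finally show "(cmod (elliptic_coeff L m \<gamma> \<phi> k))\<^sup>2 \<le> C1 * 2 powr (real j * (4 * \<gamma>)) * (cmod (?c k))\<^sup>2" .
    qed
    also have "\<dots> = C1 * (\<Sum>j<Suc J. 2 powr (real j * (4 * \<gamma>)) * block_norm ?c j powr 2)"
      by (simp only: sum_distrib_left block_norm_sq powr_numeral block_norm_nonneg mult.assoc)
    also have "\<dots> \<le> C1 * (C2 * (1 + Lq_norm L 2 \<phi> powr (3 / 2) * G powr (1 / 4)))"
      using b by (intro mult_left_mono C2(2) C1 G) (simp add: block_norm_le_Lq_norm L \<phi>)
    finally show "square_sum (elliptic_coeff L m \<gamma> \<phi>) N \<le>
        C1 * C2 * (1 + Lq_norm L 2 \<phi> powr (3 / 2) * G powr (1 / 4))" by (simp add: mult.assoc)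
  qed
qed

lemma one_plus_powr_le:
  fixes u a :: real
  assumes "0 \<le> u" "0 < a"
  shows "(1 + u) powr a \<le> 2 powr a * (1 + u powr a)"
proof -
  have "(1 + u) powr a \<le> (2 * max 1 u) powr a" using assms by (intro powr_mono2) auto
  also have "\<dots> = 2 powr a * max 1 u powr a" by (rule powr_mult)
  also have "max 1 u powr a \<le> 1 + u powr a" by (auto simp: max_def)
  finally show ?thesis by (simp add: mult_left_mono)
qed

text \<open>The exponents come from the interpolation parameters \<open>7/20 > 1/3\<close> for \<open>\<parallel>\<phi>\<parallel>\<^sub>6\<close> and \<open>1/4 > 2 \<gamma>\<close> for the
  \<open>H\<^sup>2\<^sup>\<gamma>\<close> norm; both satisfy \<open>a / (1 - b) < 18\<close>.\<close>

lemma cubic_pairing_elliptic_power_bound: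
  assumes L: "L > 0" and m: "m > 0" and \<gamma>: "\<gamma> < 1 / 8" and K: "K \<ge> 0"
  shows "\<exists>C\<ge>0. \<forall>\<phi> G. continuous_on UNIV \<phi> \<longrightarrow> (\<forall>x. \<phi> (x + L) = \<phi> x) \<longrightarrow> 0 \<le> G \<longrightarrow>
      (\<forall>j. (block_norm (\<lambda>k. fourier_coeff L k \<phi>) j)\<^sup>2 \<le> K * (1 / 2 ^ j + G / 4 ^ j)) \<longrightarrow>
      cmod (cubic_pairing L \<phi> (elliptic_power L m \<gamma> \<phi>)) \<le> C * (1 +
        Lq_norm L 2 \<phi> powr (117 / 40) * G powr (63 / 80) + Lq_norm L 2 \<phi> powr (9 / 4) * G powr (3 / 8))"
proof -
  obtain A where A: "A \<ge> 0" "\<And>\<phi> G. continuous_on UNIV \<phi> \<Longrightarrow> (\<And>x. \<phi> (x + L) = \<phi> x) \<Longrightarrow> 0 \<le> G \<Longrightarrow>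
      (\<And>j. (block_norm (\<lambda>k. fourier_coeff L k \<phi>) j)\<^sup>2 \<le> K * (1 / 2 ^ j + G / 4 ^ j)) \<Longrightarrow>
      (\<integral>x. cmod (\<phi> x) powr 6 \<partial>circle_measure L) \<le>
        A * (1 + Lq_norm L 2 \<phi> powr (39 / 10) * G powr (21 / 20))"
    using Lp_norm_bound[OF L, of 6 "7 / 20" K] K by auto
  obtain B where B: "B \<ge> 0" "\<And>\<phi> G N. continuous_on UNIV \<phi> \<Longrightarrow> 0 \<le> G \<Longrightarrow>
      (\<And>j. (block_norm (\<lambda>k. fourier_coeff L k \<phi>) j)\<^sup>2 \<le> K * (1 / 2 ^ j + G / 4 ^ j)) \<Longrightarrow>
      square_sum (elliptic_coeff L m \<gamma> \<phi>) N \<le> B * (1 + Lq_norm L 2 \<phi> powr (3 / 2) * G powr (1 / 4))"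
    using square_sum_elliptic_bound[OF L m \<gamma> K] by blast
  define A' where "A' = A powr (3 / 4) * 2 powr (3 / 4)"
  define B' where "B' = B powr (3 / 2) * 2 powr (3 / 2)"
  have AB: "0 \<le> A'" "0 \<le> B'" by (auto simp: A'_def B'_def)
  show ?thesis
  proof (intro exI[of _ "A' + B'"] conjI allI impI)
    show "0 \<le> A' + B'" using AB by simp
    fix \<phi> :: "real \<Rightarrow> complex" and G :: real
    assume \<phi>: "continuous_on UNIV \<phi>" "\<forall>x. \<phi> (x + L) = \<phi> x" and G: "0 \<le> G"
      and b: "\<forall>j. (block_norm (\<lambda>k. fourier_coeff L k \<phi>) j)\<^sup>2 \<le> K * (1 / 2 ^ j + G / 4 ^ j)"
    define N where "N = Lq_norm L 2 \<phi>"
    have N: "N \<ge> 0" by (simp add: N_def)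
    define X where "X = (\<integral>x. cmod (\<phi> x) powr 6 \<partial>circle_measure L)"
    have X0: "0 \<le> X" unfolding X_def by (auto intro!: integral_nonneg_AE)
    have X: "X \<le> A * (1 + N powr (39 / 10) * G powr (21 / 20))"
      unfolding X_def N_def using A(2)[OF \<phi>(1)] \<phi>(2) G b by blast
    have "X powr (3 / 4) \<le> (A * (1 + N powr (39 / 10) * G powr (21 / 20))) powr (3 / 4)"
      using X X0 by (intro powr_mono2) auto
    also have "\<dots> \<le> A powr (3 / 4) * (2 powr (3 / 4) * (1 + (N powr (39 / 10) * G powr (21 / 20)) powr (3 / 4)))"
      unfolding powr_mult[of A] by (intro mult_left_mono one_plus_powr_le) auto
    finally have X': "X powr (3 / 4) \<le> A' * (1 + N powr (117 / 40) * G powr (63 / 80))"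
      by (simp add: A'_def powr_mult powr_powr mult.assoc)
    define U where "U = 1 + N powr (117 / 40) * G powr (63 / 80) + N powr (9 / 4) * G powr (3 / 8)"
    have bound: "cmod (cubic_pairing L \<phi> (symmetric_sum L (elliptic_coeff L m \<gamma> \<phi>) n)) \<le> (A' + B') * U" for n
    proof -
      define Y where "Y = square_sum (elliptic_coeff L m \<gamma> \<phi>) n"
      have "Y \<le> B * (1 + N powr (3 / 2) * G powr (1 / 4))"
        unfolding Y_def N_def using B(2)[OF \<phi>(1)] G b by blast
      then have "Y powr (3 / 2) \<le> (B * (1 + N powr (3 / 2) * G powr (1 / 4))) powr (3 / 2)"
        using square_sum_nonneg by (intro powr_mono2) (auto simp: Y_def)
      also have "\<dots> \<le> B powr (3 / 2) * (2 powr (3 / 2) * (1 + (N powr (3 / 2) * G powr (1 / 4)) powr (3 / 2)))"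
        unfolding powr_mult[of B] by (intro mult_left_mono one_plus_powr_le) auto
      finally have Y': "Y powr (3 / 2) \<le> B' * (1 + N powr (9 / 4) * G powr (3 / 8))"
        by (simp add: B'_def powr_mult powr_powr mult.assoc)
      have "continuous_on UNIV (symmetric_sum L (elliptic_coeff L m \<gamma> \<phi>) n)" by (intro continuous_intros)
      from cubic_pairing_bound[OF \<phi>(1) this, of L]
      have "cmod (cubic_pairing L \<phi> (symmetric_sum L (elliptic_coeff L m \<gamma> \<phi>) n)) \<le> X powr (3 / 4) + Y powr (3 / 2)"
        by (simp add: cubic_pairing_def circle_integral_eq integral_symmetric_sum[OF L] X_def Y_def)
      also have "\<dots> \<le> A' * (1 + N powr (117 / 40) * G powr (63 / 80)) + B' * (1 + N powr (9 / 4) * G powr (3 / 8))"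
        using X' Y' by (rule add_mono)
      also have "\<dots> \<le> A' * U + B' * U" 
        unfolding U_def by (rule add_mono; rule mult_left_mono) (use AB in auto)
      finally show ?thesis by (simp add: algebra_simps)
    qed
    \<comment> \<open>Off the domain the approximating sequence is constantly 0, so the bound has to
      be nonnegative as well.\<close>
    have U: "0 \<le> (A' + B') * U" using AB by (simp add: U_def)
    have "cmod (cubic_pairing L \<phi> (elliptic_power L m \<gamma> \<phi>)) \<le> (A' + B') * U"
      by (rule LIMSEQ_le_const2[OF tendsto_norm[OF cubic_pairing_elliptic_power_tendsto[OF L \<phi>(1)]]])
        (use bound U in auto)
    then show "cmod (cubic_pairing L \<phi> (elliptic_power L m \<gamma> \<phi>)) \<le> (A' + B') * (1 +
        Lq_norm L 2 \<phi> powr (117 / 40) * G powr (63 / 80) + Lq_norm L 2 \<phi> powr (9 / 4) * G powr (3 / 8))"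
      by (simp add: U_def N_def)
  qed
qed

section \<open>Exponential integrability\<close>

text \<open>Each of the two products is absorbed at the cost of half of \<open>ln (H x)\<close> and
  half of the \<kappa> term. Together they use exactly one \<open>ln (H x)\<close>, whose
  exponential is \<open>H x\<close>; only the first power of \<open>H\<close> is known to be
  integrable.\<close>

lemma integrable_exp_of_bound:
  fixes F N H :: "'a \<Rightarrow> real"
  assumes [measurable]: "F \<in> borel_measurable M" "N \<in> borel_measurable M"
    and H: "integrable M H" and "A \<ge> 0" "\<kappa> > 0"
    and e1: "0 < a1" "0 < b1" "b1 < 1" "a1 / (1 - b1) < q"
    and e2: "0 < a2" "0 < b2" "b2 < 1" "a2 / (1 - b2) < q"
    and bound: "AE x in M. 1 \<le> H x \<and> 0 \<le> N x \<and>
      F x \<le> A * (1 + N x powr a1 * ln (H x) powr b1 + N x powr a2 * ln (H x) powr b2)"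
  shows "integrable M (\<lambda>x. exp (F x - \<kappa> * N x powr q))"
proof -
  obtain C1 where C1: "\<And>x y. 0 \<le> x \<Longrightarrow> 0 \<le> y \<Longrightarrow> A * (x powr a1 * y powr b1) \<le> 1 / 2 * y + \<kappa> / 2 * x powr q + C1"
    using young_absorb[OF e1 \<open>A \<ge> 0\<close>, of "1 / 2" "\<kappa> / 2"] \<open>\<kappa> > 0\<close> by auto
  obtain C2 where C2: "\<And>x y. 0 \<le> x \<Longrightarrow> 0 \<le> y \<Longrightarrow> A * (x powr a2 * y powr b2) \<le> 1 / 2 * y + \<kappa> / 2 * x powr q + C2"
    using young_absorb[OF e2 \<open>A \<ge> 0\<close>, of "1 / 2" "\<kappa> / 2"] \<open>\<kappa> > 0\<close> by auto
  show ?thesis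
  proof (rule Bochner_Integration.integrable_bound)
    show "integrable M (\<lambda>x. exp (A + C1 + C2) * H x)" using H by simp
    show "AE x in M. norm (exp (F x - \<kappa> * N x powr q)) \<le> norm (exp (A + C1 + C2) * H x)"
      using bound
    proof eventually_elim
      case (elim x)
      then have ln: "0 \<le> ln (H x)" by simp
      have "F x \<le> A + A * (N x powr a1 * ln (H x) powr b1) + A * (N x powr a2 * ln (H x) powr b2)"
        using elim by (simp add: algebra_simps)
      also have "\<dots> \<le> A + (1 / 2 * ln (H x) + \<kappa> / 2 * N x powr q + C1) + (1 / 2 * ln (H x) + \<kappa> / 2 * N x powr q + C2)"
        using elim ln by (intro add_mono C1 C2) auto
      finally have "F x - \<kappa> * N x powr q \<le> (A + C1 + C2) + ln (H x)" by (simp add: algebra_simps)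
      then have "exp (F x - \<kappa> * N x powr q) \<le> exp ((A + C1 + C2) + ln (H x))" by simp
      also have "\<dots> = exp (A + C1 + C2) * H x" using elim by (simp add: exp_add)
      finally show ?case by simp
    qed
  qed measurable
qed

text \<open>After cross-multiplication the difference is (1 - 2 \<alpha>) (p - 2)^2. Equality would
  occur at \<alpha> = 1/2, so every admissible \<alpha> imposes at least the condition of that end
  point.\<close>

lemma critical_exponent_le:
  fixes p \<alpha> r :: real
  assumes p: "2 < p" "p < 6" and \<alpha>: "\<alpha> < 1 / 2" "4 * \<alpha> + 4 - p > 0"
  shows "(p + 2) / (6 - p) \<le> (2 * \<alpha> * p + 2) / (4 * \<alpha> + 4 - p)"
proof -
  have "(2 * \<alpha> * p + 2) * (6 - p) - (p + 2) * (4 * \<alpha> + 4 - p) = (1 - 2 * \<alpha>) * (p - 2)\<^sup>2"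
    by (simp add: algebra_simps power2_eq_square)
  moreover have "0 \<le> (1 - 2 * \<alpha>) * (p - 2)\<^sup>2" using \<alpha> by simp
  ultimately have le: "(p + 2) * (4 * \<alpha> + 4 - p) \<le> (2 * \<alpha> * p + 2) * (6 - p)" by linarith
  have "p + 2 = (p + 2) * (4 * \<alpha> + 4 - p) / (4 * \<alpha> + 4 - p)" using \<alpha> by simp
  also have "\<dots> \<le> (2 * \<alpha> * p + 2) * (6 - p) / (4 * \<alpha> + 4 - p)"
    using le \<alpha> by (intro divide_right_mono) auto
  finally show ?thesis using p by (simp add: pos_divide_le_eq)
qed

text \<open>At s0 = (p - 2) / (2 p) one has p (1 - s0) = (p + 2) / 2 and 1 - p s0 / 2 = (6 - p) / 4,
  so the last inequality is the hypothesis on r. Strict inequalities persist slightly to the right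
  of s0, where \<open>Lp_norm_bound\<close> applies.\<close>

lemma interpolation_exponent:
  fixes p r :: real
  assumes p: "2 < p" "p < 6" and r: "(p + 2) / (6 - p) < r"
  obtains s where "(p - 2) / (2 * p) < s" "s < 1" "p * s / 2 < 1" "p * (1 - s) / (1 - p * s / 2) < 2 * r"
proof -
  define s0 where "s0 = (p - 2) / (2 * p)"
  have ps0: "p * s0 = (p - 2) / 2" using p by (simp add: s0_def)
  have s0: "s0 < 1" using p by (simp add: s0_def)
  have 1: "p * s0 / 2 < 1" unfolding ps0 using p by simp
  have "p + 2 < r * (6 - p)" using r p by (simp add: divide_less_eq)
  then have 2: "0 < 2 * r * (1 - p * s0 / 2) - p * (1 - s0)"
    unfolding right_diff_distrib[of p] ps0 by (simp add: field_simps)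
  have "\<forall>\<^sub>F s in at_right s0. s < 1" by (intro order_tendstoD(2)[OF tendsto_ident_at s0])
  moreover have "\<forall>\<^sub>F s in at_right s0. p * s / 2 < 1"
    by (intro order_tendstoD(2)[OF _ 1] tendsto_intros) auto
  moreover have "\<forall>\<^sub>F s in at_right s0. 0 < 2 * r * (1 - p * s / 2) - p * (1 - s)"
    by (intro order_tendstoD(1)[OF _ 2] tendsto_intros) auto
  moreover have "\<forall>\<^sub>F s in at_right s0. s0 < s" by (rule eventually_at_right_less)
  ultimately have "\<forall>\<^sub>F s in at_right s0. s0 < s \<and> s < 1 \<and> p * s / 2 < 1 \<and> 0 < 2 * r * (1 - p * s / 2) - p * (1 - s)"
    by eventually_elim auto
  then obtain s where s: "s0 < s" "s < 1" "p * s / 2 < 1" "0 < 2 * r * (1 - p * s / 2) - p * (1 - s)"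
    using eventually_happens' trivial_limit_at_right_real by blast
  then have "p * (1 - s) / (1 - p * s / 2) < 2 * r"
    by (subst pos_divide_less_eq) auto
  then show ?thesis using s s0_def that by blast
qed

theorem theorem3p6:
  fixes L m \<beta> :: real and M :: "(real \<Rightarrow>\<^sub>C complex) measure"
  assumes "L > 0" and "m > 0" and "\<beta> > 0"
    and "is_gaussian_measure L m \<beta> M"
  shows "(\<forall>(p::real) (lam::real) (\<kappa>::real) (r::real).
            2 < p \<longrightarrow> p < 6 \<longrightarrow> \<kappa> > 0 \<longrightarrow>
            (\<exists>\<alpha>::real. 0 < \<alpha> \<and> \<alpha> < 1/2 \<and> 4 * \<alpha> + 4 - p > 0 \<and>
               r > (2 * \<alpha> * p + 2) / (4 * \<alpha> + 4 - p)) \<longrightarrow>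
            integrable M (\<lambda>\<phi>. exp (lam / p * Lq_norm L p (apply_bcontfun \<phi>) powr p
                                   - \<kappa> * Lq_norm L 2 (apply_bcontfun \<phi>) powr (2 * r))))
       \<and> (\<forall>(\<mu>::real) (\<kappa>::real) (\<gamma>::real) (r::real).
            \<kappa> > 0 \<longrightarrow> \<gamma> < 1/8 \<longrightarrow> r > 9 \<longrightarrow>
            integrable M (\<lambda>\<phi>. exp (\<mu> * cmod (circle_integral L (\<lambda>x.
                                       of_real ((cmod (apply_bcontfun \<phi> x))\<^sup>2) * cnj (apply_bcontfun \<phi> x)
                                       * elliptic_power L m \<gamma> (apply_bcontfun \<phi>) x))
                                   - \<kappa> * Lq_norm L 2 (apply_bcontfun \<phi>) powr (2 * r))))"
proof -
  note L = \<open>L > 0\<close> and m = \<open>m > 0\<close> and M = \<open>is_gaussian_measure L m \<beta> M\<close>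
  obtain K H where K: "K \<ge> 0" and H: "integrable M H" and
    KH: "AE \<phi> in M. 1 \<le> H \<phi> \<and> (\<forall>j. (block_norm (\<lambda>k. fourier_coeff L k (apply_bcontfun \<phi>)) j)\<^sup>2
        \<le> K * (1 / 2 ^ j + ln (H \<phi>) / 4 ^ j))"
    using gaussian_block_bounds[OF L m \<open>\<beta> > 0\<close> M] by blast
  have meas_norm: "(\<lambda>\<phi>. Lq_norm L q (apply_bcontfun \<phi>)) \<in> borel_measurable M" if "q > 0" for q
    by (rule gaussian_measurable[OF M continuous_Lq_norm[OF that]])
  have per: "AE \<phi> in M. \<forall>x. apply_bcontfun \<phi> (x + L) = apply_bcontfun \<phi> x"
    using space_gaussian[OF M] by (intro AE_I2) (auto simp: circle_fun_def)
  show ?thesis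
  proof (intro conjI allI impI)
    fix p lam \<kappa> r :: real
    assume p: "2 < p" "p < 6" and "\<kappa> > 0"
      and "\<exists>\<alpha>::real. 0 < \<alpha> \<and> \<alpha> < 1/2 \<and> 4 * \<alpha> + 4 - p > 0 \<and> r > (2 * \<alpha> * p + 2) / (4 * \<alpha> + 4 - p)"
    then have "(p + 2) / (6 - p) < r" using critical_exponent_le[OF p] by (meson order.strict_trans1)
    then obtain s where s: "(p - 2) / (2 * p) < s" "s < 1" "p * s / 2 < 1" "p * (1 - s) / (1 - p * s / 2) < 2 * r"
      using interpolation_exponent[OF p] by blast
    have "0 < (p - 2) / (2 * p)" using p by simp
    then have s0: "0 < s" using s by linarith
    obtain C where C: "C \<ge> 0" "\<And>\<phi> G. continuous_on UNIV \<phi> \<Longrightarrow> \<forall>x. \<phi> (x + L) = \<phi> x \<Longrightarrow> 0 \<le> G \<Longrightarrow>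
      \<forall>j. (block_norm (\<lambda>k. fourier_coeff L k \<phi>) j)\<^sup>2 \<le> K * (1 / 2 ^ j + G / 4 ^ j) \<Longrightarrow>
      (\<integral>x. cmod (\<phi> x) powr p \<partial>circle_measure L) \<le>
        C * (1 + Lq_norm L 2 \<phi> powr (p * (1 - s)) * G powr (p * s / 2))"
      using Lp_norm_bound[OF L p(1) s(1,2) K] by blast
    show "integrable M (\<lambda>\<phi>. exp (lam / p * Lq_norm L p (apply_bcontfun \<phi>) powr p
                                   - \<kappa> * Lq_norm L 2 (apply_bcontfun \<phi>) powr (2 * r)))"
    proof (rule integrable_exp_of_bound[OF _ _ H])
      have [measurable]: "(\<lambda>\<phi>. Lq_norm L p (apply_bcontfun \<phi>)) \<in> borel_measurable M"
        using meas_norm p by simp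
      show "(\<lambda>\<phi>. lam / p * Lq_norm L p (apply_bcontfun \<phi>) powr p) \<in> borel_measurable M"
        by measurable
      show "AE \<phi> in M. 1 \<le> H \<phi> \<and> 0 \<le> Lq_norm L 2 (apply_bcontfun \<phi>) \<and>
          lam / p * Lq_norm L p (apply_bcontfun \<phi>) powr p \<le> \<bar>lam / p\<bar> * C * (1 +
            Lq_norm L 2 (apply_bcontfun \<phi>) powr (p * (1 - s)) * ln (H \<phi>) powr (p * s / 2) +
            Lq_norm L 2 (apply_bcontfun \<phi>) powr (p * (1 - s)) * ln (H \<phi>) powr (p * s / 2))"
        using KH per
      proof eventually_elim
        case (elim \<phi>)
        let ?t = "Lq_norm L 2 (apply_bcontfun \<phi>) powr (p * (1 - s)) * ln (H \<phi>) powr (p * s / 2)"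
        have "Lq_norm L p (apply_bcontfun \<phi>) powr p \<le> C * (1 + ?t)"
          using C(2)[OF continuous_bcontfun_UNIV, of \<phi> "ln (H \<phi>)"] elim p by (simp add: Lq_norm_powr)
        \<comment> \<open>A single product occurs here; it is listed twice to fit the two slots of
          \<open>integrable_exp_of_bound\<close>.\<close>
        also have "\<dots> \<le> C * (1 + ?t + ?t)" using C(1) by (intro mult_left_mono) auto
        finally have "\<bar>lam / p\<bar> * Lq_norm L p (apply_bcontfun \<phi>) powr p \<le> \<bar>lam / p\<bar> * (C * (1 + ?t + ?t))"
          by (rule mult_left_mono) simp
        \<comment> \<open>The sign of \<open>lam\<close> is arbitrary, so the bound is taken with
          its absolute value.\<close>
        moreover have "lam / p * Lq_norm L p (apply_bcontfun \<phi>) powr p \<le> \<bar>lam / p\<bar> * Lq_norm L p (apply_bcontfun \<phi>) powr p"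
          by (rule mult_right_mono[OF abs_ge_self]) simp
        ultimately have "lam / p * Lq_norm L p (apply_bcontfun \<phi>) powr p \<le> \<bar>lam / p\<bar> * (C * (1 + ?t + ?t))"
          by (rule order_trans[rotated])
        then show ?case using elim by (simp only: mult.assoc Lq_norm_nonneg)
      qed
    qed (use s s0 p C \<open>\<kappa> > 0\<close> meas_norm[of 2] in auto)
  next
    fix \<mu> \<kappa> \<gamma> r :: real
    assume "\<kappa> > 0" and \<gamma>: "\<gamma> < 1/8" and r: "r > 9"
    let ?I = "\<lambda>\<phi>. cmod (cubic_pairing L (apply_bcontfun \<phi>) (elliptic_power L m \<gamma> (apply_bcontfun \<phi>)))"
    obtain C where C: "C \<ge> 0" "\<And>\<phi> G. continuous_on UNIV \<phi> \<Longrightarrow> \<forall>x. \<phi> (x + L) = \<phi> x \<Longrightarrow> 0 \<le> G \<Longrightarrow>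
      \<forall>j. (block_norm (\<lambda>k. fourier_coeff L k \<phi>) j)\<^sup>2 \<le> K * (1 / 2 ^ j + G / 4 ^ j) \<Longrightarrow>
      cmod (cubic_pairing L \<phi> (elliptic_power L m \<gamma> \<phi>)) \<le> C * (1 +
        Lq_norm L 2 \<phi> powr (117 / 40) * G powr (63 / 80) + Lq_norm L 2 \<phi> powr (9 / 4) * G powr (3 / 8))"
      using cubic_pairing_elliptic_power_bound[OF L m \<gamma> K] by blast
    have "integrable M (\<lambda>\<phi>. exp (\<mu> * ?I \<phi> - \<kappa> * Lq_norm L 2 (apply_bcontfun \<phi>) powr (2 * r)))"
    proof (rule integrable_exp_of_bound[OF _ _ H])
      show "(\<lambda>\<phi>. \<mu> * ?I \<phi>) \<in> borel_measurable M"
        by (rule borel_measurable_times[OF _ measurable_cubic_pairing_elliptic_power[OF L M]]) simp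
      show "AE \<phi> in M. 1 \<le> H \<phi> \<and> 0 \<le> Lq_norm L 2 (apply_bcontfun \<phi>) \<and>
          \<mu> * ?I \<phi> \<le> \<bar>\<mu>\<bar> * C * (1 +
            Lq_norm L 2 (apply_bcontfun \<phi>) powr (117 / 40) * ln (H \<phi>) powr (63 / 80) +
            Lq_norm L 2 (apply_bcontfun \<phi>) powr (9 / 4) * ln (H \<phi>) powr (3 / 8))"
        using KH per
      proof eventually_elim
        case (elim \<phi>)
        let ?t = "1 + Lq_norm L 2 (apply_bcontfun \<phi>) powr (117 / 40) * ln (H \<phi>) powr (63 / 80) +
            Lq_norm L 2 (apply_bcontfun \<phi>) powr (9 / 4) * ln (H \<phi>) powr (3 / 8)"
        have "?I \<phi> \<le> C * ?t"
          using C(2)[OF continuous_bcontfun_UNIV, of \<phi> "ln (H \<phi>)"] elim by simp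
        then have "\<bar>\<mu>\<bar> * ?I \<phi> \<le> \<bar>\<mu>\<bar> * (C * ?t)" by (rule mult_left_mono) simp
        moreover have "\<mu> * ?I \<phi> \<le> \<bar>\<mu>\<bar> * ?I \<phi>" by (rule mult_right_mono[OF abs_ge_self]) simp
        ultimately have "\<mu> * ?I \<phi> \<le> \<bar>\<mu>\<bar> * (C * ?t)" by (rule order_trans[rotated])
        then show ?case using elim by (simp only: mult.assoc Lq_norm_nonneg)
      qed
    \<comment> \<open>The two ratios a / (1 - b) are 234/17 and 18/5, both below 18 < 2 r.\<close>
    qed (use r C \<open>\<kappa> > 0\<close> meas_norm[of 2] in auto)
    then show "integrable M (\<lambda>\<phi>. exp (\<mu> * cmod (circle_integral L (\<lambda>x.
                                       of_real ((cmod (apply_bcontfun \<phi> x))\<^sup>2) * cnj (apply_bcontfun \<phi> x)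
                                       * elliptic_power L m \<gamma> (apply_bcontfun \<phi>) x))
                                   - \<kappa> * Lq_norm L 2 (apply_bcontfun \<phi>) powr (2 * r)))"
      by (simp add: cubic_pairing_def)
  qed
qed

end
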